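(* Let $x=t/8$. For every root of unity $\zeta$ and every integer $n\ge0$, as $t\to0^+$ one has the (Poincaré) asymptotic expansion $$N_n(\zeta e^{-t})\sim e^x\left\{\frac{\mu_\zeta}{2}\,n!\,x^{-n-1}+\sum_{r\ge0}\frac{(-1)^r}{r!}L(-2n-2r-1,b_\zeta)\,x^r\right\},$$ where the mean term is omitted if $\mu_\zeta=0$. If $\operatorname{ord}(\zeta)\equiv2\pmod4$, then $$W_n(\zeta e^{-t})\sim n!\left(\frac8t\right)^n\qquad(t\to0^+).$$ At every other root of unity $\zeta$, $$\lim_{t\to0^+}W_n(\zeta e^{-t})=\frac{L(-2n-1,b_\zeta)}{L(-1,b_\zeta)},$$ and the limit is finite and nonzero. For every fixed $\zeta$, the denominator $D(\zeta e^{-t})$ is nonzero on some interval $0<t<t_0(\zeta)$.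
   Context: Put $T_k=k(k+1)/2$ and let $\chi_8(m)=\left(\frac2m\right)$ be the primitive even quadratic character modulo $8$. For integers $n\ge0$ and complex $|q|<1$, $$N_n(q):=\sum_{k\ge0}(-1)^{T_k}(2k+1)^{2n+1}q^{T_k},\qquad D(q):=N_0(q),\qquad W_n(q):=\frac{N_n(q)}{D(q)}$$ ($W_n$ being considered away from the zeros of $D$). $\operatorname{ord}(\zeta)$ denotes the order of a root of unity $\zeta$. For a root of unity $\zeta$, define the periodic sequence $$b_\zeta(m):=\begin{cases}\chi_8(m)\,\zeta^{(m^2-1)/8},&m\text{ odd},\\0,&m\text{ even}\end{cases}\qquad(m\in\mathbb Z).$$ For any period $M$ of $b_\zeta$, its mean is $\mu_\zeta:=\frac1M\sum_{r=1}^Mb_\zeta(r)$. For $\Re(s)>1$, $L(s,b_\zeta):=\sum_{m\ge1}b_\zeta(m)m^{-s}$, continued meromorphically to $\mathbb C$ by $L(s,b_\zeta)=M^{-s}\sum_{r=1}^Mb_\zeta(r)\zeta(s,r/M)$ (Hurwitz zeta function), with at most a simple pole at $s=1$ of residue $\mu_\zeta$. *)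

theory Defs
  imports "HOL-Complex_Analysis.Complex_Analysis" "HOL-Library.Landau_Symbols"
begin

definition root_of_unity :: "complex \<Rightarrow> bool" where
  "root_of_unity \<zeta> \<longleftrightarrow> (\<exists>k>0. \<zeta> ^ k = 1)"

definition root_order :: "complex \<Rightarrow> nat" where
  "root_order \<zeta> = (LEAST k. k > 0 \<and> \<zeta> ^ k = 1)"

definition tri :: "nat \<Rightarrow> nat" where
  "tri k = k * (k + 1) div 2"

definition N_series :: "nat \<Rightarrow> complex \<Rightarrow> complex" where
  "N_series n q = (\<Sum>k. (-1) ^ tri k * of_nat (2 * k + 1) ^ (2 * n + 1) * q ^ tri k)"

definition D_series :: "complex \<Rightarrow> complex" where
  "D_series q = N_series 0 q"

definition W_quot :: "nat \<Rightarrow> complex \<Rightarrow> complex" where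
  "W_quot n q = N_series n q / D_series q"

(* the Kronecker symbol (2/m) *)
definition chi8 :: "int \<Rightarrow> int" where
  "chi8 m = (if even m then 0 else if m mod 8 \<in> {1, 7} then 1 else -1)"

definition b_seq :: "complex \<Rightarrow> int \<Rightarrow> complex" where
  "b_seq \<zeta> m = (if odd m then of_int (chi8 m) * \<zeta> ^ nat ((m\<^sup>2 - 1) div 8) else 0)"

definition is_period :: "(int \<Rightarrow> complex) \<Rightarrow> nat \<Rightarrow> bool" where
  "is_period f M \<longleftrightarrow> M > 0 \<and> (\<forall>m. f (m + int M) = f m)"

(* Formed with the least period; mean_eq below shows that every period gives the same value. *)
definition mean :: "(int \<Rightarrow> complex) \<Rightarrow> complex" where
  "mean f = (let M = (LEAST M. is_period f M) in (\<Sum>r=1..M. f (int r)) / of_nat M)"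

definition mu :: "complex \<Rightarrow> complex" where
  "mu \<zeta> = mean (b_seq \<zeta>)"

(* F is the continuation to the complex plane minus {1} of the Dirichlet series of f.  Such an
   F is unique off s = 1 by the identity theorem.  If f has period M, it exists and is given by
   F s = M powr (-s) * (sum over r = 1..M of f r * zeta(s, r/M)), with zeta the Hurwitz zeta function. *)
definition continues_Dirichlet_series :: "(int \<Rightarrow> complex) \<Rightarrow> (complex \<Rightarrow> complex) \<Rightarrow> bool" where
  "continues_Dirichlet_series f F \<longleftrightarrow>
     F holomorphic_on (- {1}) \<and>
     (\<forall>s. Re s > 1 \<longrightarrow> (\<lambda>k. f (int (Suc k)) * of_nat (Suc k) powr (- s)) sums F s)"

(* The value at s = 1 is unspecified. *)
definition L_fun :: "complex \<Rightarrow> (int \<Rightarrow> complex) \<Rightarrow> complex" where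
  "L_fun s f = (SOME F. continues_Dirichlet_series f F) s"

lemma L_fun_unique:
  assumes F: "continues_Dirichlet_series f F" and s: "s \<noteq> 1"
  shows "L_fun s f = F s"
proof -
  define G where "G = (SOME F. continues_Dirichlet_series f F)"
  have G: "continues_Dirichlet_series f G"
    unfolding G_def using someI[of "continues_Dirichlet_series f" F] F by simp
  have "G s - F s = 0"
  proof (rule analytic_continuation[of "\<lambda>s. G s - F s" "- {1}" "{s. Re s > 1}" 2])
    show "(\<lambda>s. G s - F s) holomorphic_on - {1}"
      using F G by (auto simp: continues_Dirichlet_series_def intro!: holomorphic_intros)
    show "connected (- {1::complex})"
      by (rule connected_punctured_universe) simp
    show "(2::complex) islimpt {s. Re s > 1}"
      by (rule interior_limit_point) (simp add: interior_open open_halfspace_Re_gt)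
    show "G z - F z = 0" if "z \<in> {s. Re s > 1}" for z
      using F G that sums_unique2 by (fastforce simp: continues_Dirichlet_series_def)
  qed (use s in auto)
  then show ?thesis by (simp add: L_fun_def G_def)
qed

lemma is_period_b_seq:
  assumes "k > 0" "\<zeta> ^ k = 1"
  shows "is_period (b_seq \<zeta>) (8 * k)"
proof -
  have "b_seq \<zeta> (m + int (8 * k)) = b_seq \<zeta> m" for m
  proof (cases "odd m")
    case True
    have pow: "\<zeta> powi (int k * j) = 1" for j
      using assms(2) by (simp add: power_int_mult)
    have nz: "\<zeta> \<noteq> 0" using assms by (metis power_eq_0_iff zero_neq_one)
    have nonneg: "x\<^sup>2 - 1 \<ge> 0" if "odd x" for x :: int
      using that by (cases "x = 0") (auto simp: power2_eq_square int_one_le_iff_zero_less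
          zero_less_mult_iff)
    have e: "((m + int (8*k))\<^sup>2 - 1) div 8 = (m\<^sup>2 - 1) div 8 + int k * (2*m + 8 * int k)"
    proof -
      have "(m + int (8*k))\<^sup>2 - 1 = (m\<^sup>2 - 1) + 8 * (int k * (2*m + 8 * int k))"
        by (simp add: power2_eq_square algebra_simps)
      then show ?thesis by simp
    qed
    have p: "\<zeta> ^ nat ((x\<^sup>2 - 1) div 8) = \<zeta> powi ((x\<^sup>2 - 1) div 8)" if "odd x" for x :: int
      using nonneg[OF that] by (simp add: power_int_def pos_imp_zdiv_nonneg_iff)
    have odd': "odd (m + int (8*k))" using True by simp
    have chi: "chi8 (m + int (8*k)) = chi8 m" by (simp add: chi8_def)
    show ?thesis
      unfolding b_seq_def chi p[OF True] p[OF odd'] unfolding e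
      using nz True odd' power_int_add[of \<zeta> "(m\<^sup>2 - 1) div 8" "int k * (2*m + 8 * int k)"] pow by simp
  qed (simp add: b_seq_def)
  with assms show ?thesis by (simp add: is_period_def)
qed

lemma mean_eq:
  assumes M: "is_period f M"
  shows "mean f = (\<Sum>r=1..M. f (int r)) / of_nat M"
proof -
  have block: "(\<Sum>r=1..j*P. f (int r)) = of_nat j * (\<Sum>r=1..P. f (int r))"
    if P: "is_period f P" for P j
  proof (induction j)
    case (Suc j)
    have sh: "f (int r + int j * int P) = f (int r)" for r
      using P by (induction j) (auto simp: is_period_def algebra_simps, metis add.commute add.left_commute)
    have "(\<Sum>r=1..Suc j*P. f (int r)) = (\<Sum>r=1..j*P. f (int r)) + (\<Sum>r=j*P+1..j*P+P. f (int r))"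
      by (subst sum.ub_add_nat[symmetric]) (auto simp: algebra_simps)
    also have "(\<Sum>r=j*P+1..j*P+P. f (int r)) = (\<Sum>r=1..P. f (int (r + j*P)))"
      using sum.shift_bounds_cl_nat_ivl[of "\<lambda>r. f (int r)" 1 "j*P" P] by (simp add: add.commute)
    also have "\<dots> = (\<Sum>r=1..P. f (int r))" using sh by simp
    finally show ?case using Suc by (simp add: algebra_simps)
  qed simp
  define P where "P = (LEAST M. is_period f M)"
  have P: "is_period f P" unfolding P_def using M by (rule LeastI)
  have "of_nat P * (\<Sum>r=1..M. f (int r)) = of_nat M * (\<Sum>r=1..P. f (int r))"
    using block[OF M, of P] block[OF P, of M] by (simp add: mult.commute)
  moreover have "P > 0" "M > 0" using M P by (auto simp: is_period_def)
  ultimately show ?thesis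
    by (simp add: mean_def Let_def P_def[symmetric] field_simps)
qed

end

theory Submission
  imports Defs
begin

text \<open>
  Writing m = 2 k + 1 turns the series into a Gaussian sum: as chi8 m is (-1)^(k(k+1)/2), the
  value N_n(zeta e^(-t)) equals e^x times the sum of b(m) m^(2n+1) e^(-x m^2) over
  m \<ge> 1, where x = t/8 and b is periodic. Everything about this sum comes from one device,
  Euler--Maclaurin summation for a coefficient sequence f of period M. Its constants are
  the coefficients \<beta>_i of the power series z * (\<Sum>r=1..M. f(r) e^(r z)) / (e^(M z) - 1), that is,
  Leopoldt's generalized Bernoulli numbers divided by i!. With them, a sum of f(m) g(m) over a block
  of M consecutive integers is \<Sum>i. \<beta>_i (G_i(end) - G_i(start)), where G_0 is a primitive of g and
  G_(i+1) is the derivative of G_i, up to an error controlled by one high derivative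
  (\<open>euler_maclaurin_block\<close>). Adding up the blocks makes the main terms telescope.

  Applied to g(y) = y^(2n+1) e^(-x y^2) on the half-line from 0, the telescoped sum leaves only the
  derivatives of g at 0, and these are the terms of the asymptotic expansion. The mean enters as
  \<beta>_0 (\<open>gaussian_sum_expansion\<close>). Applied to g(y) = y^(-s) from M onwards, the same formula has
  an error term that converges in a larger half-plane, and so it continues L(s, f). At
  s = -k the function g is a polynomial, the formula is exact, and it gives
  L(-k, f) = - k! \<beta>_(k+1) (\<open>periodic_Dirichlet_series_continuation\<close>). Hence the coefficients of
  the Gaussian sum are L-values, with no Mellin transform and no contour integral.

  It remains to see when these L-values vanish. If f is even with vanishing mean, the partial fraction
  expansion of the cotangent, in the form of the reflection formula of the digamma function,
  expresses \<beta>_(k+1) for odd k as a nonzero multiple of the sum of c_j / j^(k+1) over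
  j \<ge> 1, where c is the discrete Fourier transform of f.
  For f = b let N be the order of -zeta; this is odd iff the order of zeta is 2 modulo 4.
  Then b(2k+1) is a quadratic chirp, (-zeta) to the power k(k+1)/2, of period 4N in 2k+1. Completing
  the square shows that its Gauss sums c_j vanish for j congruent to N modulo 2, and that all others
  have the same absolute value, which is nonzero by Fourier inversion.
  For odd N this includes c_0, so the mean is nonzero and the pole term dominates the ratio W_n.
  For even N the mean is zero, and c_j is supported on odd j with constant absolute value. The
  term j = 1 then outweighs all the others, since \<Sum>j odd. 1/j^2 is below 2, so
  no L-value occurring here is zero (\<open>periodic_bernoulli_nonzero\<close>).
\<close>

section \<open>Euler--Maclaurin summation with periodic coefficients\<close>

text \<open>The series z * (\<Sum>r=1..M. f(r) e^(r z)) / (e^(M z) - 1). As e^(M z) - 1 has no constant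
  term, the factor z is absorbed by shifting the denominator, which makes it invertible.\<close>

definition periodic_bernoulli_fps :: "(int \<Rightarrow> complex) \<Rightarrow> nat \<Rightarrow> complex fps" where
  "periodic_bernoulli_fps f M =
     (\<Sum>r=1..M. fps_const (f (int r)) * fps_exp (of_nat r)) *
     inverse (fps_shift 1 (fps_exp (of_nat M) - 1))"

abbreviation periodic_bernoulli :: "(int \<Rightarrow> complex) \<Rightarrow> nat \<Rightarrow> nat \<Rightarrow> complex" where
  "periodic_bernoulli f M i \<equiv> fps_nth (periodic_bernoulli_fps f M) i"

lemma periodic_bernoulli_fps_eq:
  assumes "M > 0"
  shows "periodic_bernoulli_fps f M * (fps_exp (of_nat M) - 1) =
           fps_X * (\<Sum>r=1..M. fps_const (f (int r)) * fps_exp (of_nat r))"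
proof -
  define E where "E = fps_shift 1 (fps_exp (of_nat M) - 1 :: complex fps)"
  have E: "fps_exp (of_nat M) - 1 = fps_X * E"
    by (rule fps_ext) (auto simp: E_def fps_eq_iff)
  have "fps_nth E 0 \<noteq> 0" using assms by (simp add: E_def)
  then have "inverse E * E = 1" by (rule inverse_mult_eq_1)
  then show ?thesis
    unfolding periodic_bernoulli_fps_def E_def[symmetric]
    by (simp add: E mult.assoc mult.left_commute[of _ fps_X] del: One_nat_def)
qed

lemma periodic_bernoulli_0:
  assumes "is_period f M"
  shows "periodic_bernoulli f M 0 = mean f"
  using assms mean_eq[OF assms]
  by (simp add: periodic_bernoulli_fps_def fps_sum_nth is_period_def divide_inverse)

text \<open>Comparing coefficients of z^l in the defining equation. These are exactly the identities that make
  the Taylor polynomials of both sides of the Euler--Maclaurin formula agree.\<close>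

lemma periodic_bernoulli_recurrence:
  assumes "M > 0" "l > 0"
  shows "(\<Sum>i<l. periodic_bernoulli f M i * of_nat M ^ (l - i) / fact (l - i)) =
           (\<Sum>r=1..M. f (int r) * of_nat r ^ (l - 1) / fact (l - 1))"
proof -
  have "fps_nth (periodic_bernoulli_fps f M * (fps_exp (of_nat M) - 1)) l =
          (\<Sum>i\<le>l. periodic_bernoulli f M i *
             fps_nth (fps_exp (of_nat M) - 1) (l - i))"
    by (simp add: fps_mult_nth atMost_atLeast0)
  also have "\<dots> = (\<Sum>i<l. periodic_bernoulli f M i *
             fps_nth (fps_exp (of_nat M) - 1) (l - i))"
    by (simp add: lessThan_Suc_atMost[symmetric])
  also have "\<dots> = (\<Sum>i<l. periodic_bernoulli f M i * of_nat M ^ (l - i) / fact (l - i))"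
    by (intro sum.cong) auto
  finally show ?thesis
    using assms unfolding periodic_bernoulli_fps_eq[OF assms(1)]
    by (simp add: fps_sum_nth)
qed

text \<open>One block of the summation formula. Here G is a tower of successive derivatives; G 1 is the
  function being summed and G 0 a primitive of it. Expanding every term around the left
  end point a, the coefficients of G 1 a, ..., G K a cancel by the recurrence for the numbers
  \<beta>_i, and only Taylor remainders are left. It matters later that C depends on f, M and K
  only, and that a bound B = 0 is admitted: for polynomials the formula is then exact.\<close>

lemma euler_maclaurin_block:
  fixes f :: "int \<Rightarrow> complex"
  assumes M: "M > 0" and K: "K > 0"
  obtains C where "C \<ge> 0"
    "\<And>G a B. (\<And>i z. i \<le> K \<Longrightarrow> z \<in> closed_segment a (a + of_nat M) \<Longrightarrow>
                    (G i has_field_derivative G (Suc i) z) (at z)) \<Longrightarrow>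
              (\<And>z. z \<in> closed_segment a (a + of_nat M) \<Longrightarrow> norm (G (Suc K) z) \<le> B) \<Longrightarrow>
       norm ((\<Sum>r=1..M. f (int r) * G 1 (a + of_nat r)) -
             (\<Sum>i\<le>K. periodic_bernoulli f M i * (G i (a + of_nat M) - G i a))) \<le> C * B"
proof -
  define \<beta> where "\<beta> = periodic_bernoulli f M"
  define C1 where "C1 = (\<Sum>r=1..M. norm (f (int r)) * (real r ^ K / fact (K - 1)))"
  define C2 where "C2 = (\<Sum>i\<le>K. norm (\<beta> i) * (real M ^ Suc (K - i) / fact (K - i)))"
  show ?thesis
  proof (rule that[of "C1 + C2"])
    show "C1 + C2 \<ge> 0" by (auto simp: C1_def C2_def intro!: sum_nonneg add_nonneg_nonneg)
  next
    fix G :: "nat \<Rightarrow> complex \<Rightarrow> complex" and a :: complex and B :: real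
    define S where "S = closed_segment a (a + of_nat M)"
    assume der0: "\<And>i z. i \<le> K \<Longrightarrow> z \<in> closed_segment a (a + of_nat M) \<Longrightarrow>
              (G i has_field_derivative G (Suc i) z) (at z)"
       and bd0: "\<And>z. z \<in> closed_segment a (a + of_nat M) \<Longrightarrow> norm (G (Suc K) z) \<le> B"
    have der: "(G i has_field_derivative G (Suc i) z) (at z within S)"
      if "i \<le> K" "z \<in> S" for i z
      using der0 that by (auto simp: S_def intro: has_field_derivative_at_within)
    have bd: "norm (G (Suc K) z) \<le> B" if "z \<in> S" for z
      using bd0 that by (simp add: S_def)
    have inS: "a + of_nat r \<in> S" if "r \<le> M" for r
      unfolding S_def in_segment
      by (intro exI[of _ "real r / real M"]) (use M that in \<open>auto simp: scaleR_conv_of_real field_simps\<close>)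
    have aS: "a \<in> S" using inS[of 0] by simp
    have convS: "convex S" by (simp add: S_def)
    have taylor: "norm (G i (a + of_nat r) -
                    (\<Sum>j\<le>K-i. G (i + j) a * of_nat r ^ j / fact j))
                  \<le> B * (real r ^ Suc (K - i) / fact (K - i))"
      if "i \<le> K" "r \<le> M" for i r
      using complex_Taylor[OF convS, of "K - i" "\<lambda>j. G (i + j)" B a "a + of_nat r"]
        der bd inS[OF that(2)] aS that by auto
    define P where "P = (\<lambda>r::nat. (\<Sum>j\<le>K-1. G (Suc j) a * of_nat r ^ j / fact j))"
    define Q where "Q = (\<lambda>i. (\<Sum>l=Suc i..K. G l a * of_nat M ^ (l - i) / fact (l - i)))"
    have 1: "norm (\<Sum>r=1..M. f (int r) * (G 1 (a + of_nat r) - P r)) \<le> C1 * B"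
    proof -
      have "norm (\<Sum>r=1..M. f (int r) * (G 1 (a + of_nat r) - P r)) \<le>
              (\<Sum>r=1..M. norm (f (int r)) * (B * (real r ^ K / fact (K - 1))))"
      proof (rule sum_norm_le)
        fix r assume "r \<in> {1..M}"
        then have "norm (G 1 (a + of_nat r) - P r) \<le> B * (real r ^ K / fact (K - 1))"
          using taylor[of 1 r] K by (simp add: P_def)
        then show "norm (f (int r) * (G 1 (a + of_nat r) - P r)) \<le>
                     norm (f (int r)) * (B * (real r ^ K / fact (K - 1)))"
          unfolding norm_mult by (rule mult_left_mono) auto
      qed
      also have "\<dots> = C1 * B" by (simp add: C1_def sum_distrib_right sum_distrib_left mult_ac)
      finally show ?thesis .
    qed
    have Q_eq: "(\<Sum>j\<le>K-i. G (i + j) a * of_nat M ^ j / fact j) = G i a + Q i" if "i \<le> K" for i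
    proof -
      have "(\<Sum>j\<le>K-i. G (i + j) a * of_nat M ^ j / fact j) =
            (\<Sum>l=i..K. G l a * of_nat M ^ (l - i) / fact (l - i))"
        by (rule sum.reindex_bij_witness[of _ "\<lambda>l. l - i" "\<lambda>j. j + i"])
           (use that in \<open>auto simp: add.commute\<close>)
      also have "\<dots> = G i a + Q i"
        unfolding Q_def using that by (subst sum.atLeast_Suc_atMost) auto
      finally show ?thesis .
    qed
    have 2: "norm (\<Sum>i\<le>K. \<beta> i * (G i (a + of_nat M) - G i a - Q i)) \<le> C2 * B"
    proof -
      have "norm (\<Sum>i\<le>K. \<beta> i * (G i (a + of_nat M) - G i a - Q i)) \<le>
              (\<Sum>i\<le>K. norm (\<beta> i) * (B * (real M ^ Suc (K - i) / fact (K - i))))"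
      proof (rule sum_norm_le)
        fix i assume "i \<in> {..K}"
        then have "norm (G i (a + of_nat M) - G i a - Q i) \<le> B * (real M ^ Suc (K - i) / fact (K - i))"
          using taylor[of i M] Q_eq[of i] by (simp add: diff_diff_eq)
        then show "norm (\<beta> i * (G i (a + of_nat M) - G i a - Q i)) \<le>
                     norm (\<beta> i) * (B * (real M ^ Suc (K - i) / fact (K - i)))"
          unfolding norm_mult by (rule mult_left_mono) auto
      qed
      also have "\<dots> = C2 * B" by (simp add: C2_def sum_distrib_right sum_distrib_left mult_ac)
      finally show ?thesis .
    qed
    \<comment> \<open>The Taylor polynomials cancel: collect the coefficient of G l a on both sides.\<close>
    have 3: "(\<Sum>r=1..M. f (int r) * P r) = (\<Sum>i\<le>K. \<beta> i * Q i)"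
    proof -
      have "(\<Sum>i\<le>K. \<beta> i * Q i) = (\<Sum>i<K. \<beta> i * Q i)"
        by (simp add: lessThan_Suc_atMost[symmetric] Q_def)
      also have "\<dots> = (\<Sum>i<K. \<Sum>l=Suc i..K. \<beta> i * of_nat M ^ (l - i) / fact (l - i) * G l a)"
        by (simp add: Q_def sum_distrib_left mult_ac)
      also have "\<dots> = (\<Sum>l\<le>K. \<Sum>i<l. \<beta> i * of_nat M ^ (l - i) / fact (l - i) * G l a)"
        by (rule sum.nested_swap'[symmetric])
      also have "\<dots> = (\<Sum>l\<le>K. G l a * (\<Sum>i<l. \<beta> i * of_nat M ^ (l - i) / fact (l - i)))"
        by (simp add: sum_distrib_left mult_ac)
      also have "\<dots> = (\<Sum>l=1..K. G l a * (\<Sum>i<l. \<beta> i * of_nat M ^ (l - i) / fact (l - i)))"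
        by (intro sum.mono_neutral_right) (auto simp: not_le)
      also have "\<dots> = (\<Sum>l=1..K. G l a * (\<Sum>r=1..M. f (int r) * of_nat r ^ (l - 1) / fact (l - 1)))"
        unfolding \<beta>_def by (intro sum.cong refl arg_cong2[where f = "(*)"]
            periodic_bernoulli_recurrence M) auto
      also have "\<dots> = (\<Sum>j\<le>K-1. G (Suc j) a * (\<Sum>r=1..M. f (int r) * of_nat r ^ j / fact j))"
        by (rule sum.reindex_bij_witness[of _ Suc "\<lambda>l. l - 1"]) (use K in auto)
      also have "\<dots> = (\<Sum>j\<le>K-1. \<Sum>r=1..M. f (int r) * (G (Suc j) a * of_nat r ^ j / fact j))"
        by (simp add: sum_distrib_left mult_ac)
      also have "\<dots> = (\<Sum>r=1..M. \<Sum>j\<le>K-1. f (int r) * (G (Suc j) a * of_nat r ^ j / fact j))"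
        by (rule sum.swap)
      finally show ?thesis by (simp add: P_def sum_distrib_left)
    qed
    have "(\<Sum>r=1..M. f (int r) * G 1 (a + of_nat r)) -
             (\<Sum>i\<le>K. \<beta> i * (G i (a + of_nat M) - G i a)) =
          (\<Sum>r=1..M. f (int r) * (G 1 (a + of_nat r) - P r)) -
          (\<Sum>i\<le>K. \<beta> i * (G i (a + of_nat M) - G i a - Q i))"
      using 3 by (simp add: ring_distribs sum_subtractf)
    also have "norm \<dots> \<le> C1 * B + C2 * B"
      by (rule norm_triangle_le_diff) (use 1 2 in linarith)
    finally show "norm ((\<Sum>r=1..M. f (int r) * G 1 (a + of_nat r)) -
             (\<Sum>i\<le>K. periodic_bernoulli f M i * (G i (a + of_nat M) - G i a))) \<le> (C1 + C2) * B"
      by (simp add: \<beta>_def ring_distribs)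
  qed
qed

lemma is_period_shift:
  assumes "is_period f M"
  shows "f (m + int M * j) = f m"
proof -
  have nat_shift: "f (m + int M * int k) = f m" for m k
    using assms by (induction k) (auto simp: is_period_def algebra_simps, metis add.assoc add.commute)
  show ?thesis
  proof (cases "j \<ge> 0")
    case True
    then show ?thesis using nat_shift[of m "nat j"] by simp
  next
    case False
    then show ?thesis using nat_shift[of "m + int M * j" "nat (-j)"] by simp
  qed
qed

lemma is_period_bounded:
  assumes "is_period f M"
  obtains B where "B \<ge> 0" "\<And>m. norm (f m) \<le> B"
proof (rule that[of "\<Sum>r<M. norm (f (int r))"])
  fix m
  have M: "M > 0" using assms by (simp add: is_period_def)
  have "f m = f (m mod int M)"
    using is_period_shift[OF assms, of "m mod int M" "m div int M"] by simp
  also have "m mod int M = int (nat (m mod int M))" using M by simp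
  also have "norm (f (int (nat (m mod int M)))) \<le> (\<Sum>r<M. norm (f (int r)))"
    using M by (intro member_le_sum) (auto simp: nat_less_iff)
  finally show "norm (f m) \<le> (\<Sum>r<M. norm (f (int r)))" .
qed (auto intro: sum_nonneg)

lemma sums_periodic_blocks:
  assumes per: "is_period f M"
    and S: "(\<lambda>m. f (int (Suc m)) * g (of_nat (Suc m) :: complex)) sums S"
  shows "(\<lambda>k. \<Sum>r=1..M. f (int r) * g (of_nat (k * M) + of_nat r)) sums S"
proof -
  have M: "M > 0" using per by (simp add: is_period_def)
  have "(\<Sum>m=k*M..<k*M+M. f (int (Suc m)) * g (of_nat (Suc m))) =
        (\<Sum>r=1..M. f (int r) * g (of_nat (k * M) + of_nat r))" for k
  proof (rule sum.reindex_bij_witness[of _ "\<lambda>r. k * M + r - 1" "\<lambda>m. Suc m - k * M"])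
    fix m assume m: "m \<in> {k*M..<k*M+M}"
    then have "int (Suc m) = int (Suc m - k * M) + int M * int k"
      by (auto simp: algebra_simps of_nat_diff)
    then have "f (int (Suc m - k * M)) = f (int (Suc m))"
      using is_period_shift[OF per] by metis
    moreover have "of_nat (k * M) + of_nat (Suc m - k * M) = (of_nat (Suc m) :: complex)"
      using m by (simp add: of_nat_add[symmetric] del: of_nat_add of_nat_Suc)
    ultimately show "f (int (Suc m - k * M)) * g (of_nat (k * M) + of_nat (Suc m - k * M)) =
                f (int (Suc m)) * g (of_nat (Suc m))" by simp
  qed auto
  with sums_group[OF S M] show ?thesis by simp
qed

section \<open>Gaussian sums with a small parameter\<close>

text \<open>The polynomial p for which p(u) exp(-u^2) is the primitive of u^(2n+1) exp(-u^2) that tends to 0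
  at infinity; the recursion is integration by parts.\<close>

primrec gauss_antideriv_poly :: "nat \<Rightarrow> complex poly" where
  "gauss_antideriv_poly 0 = [:-1/2:]"
| "gauss_antideriv_poly (Suc n) = monom (-1/2) (2*n+2) + smult (of_nat (Suc n)) (gauss_antideriv_poly n)"

text \<open>The polynomial p_i for which p_i(u) exp(-u^2) is the i-th derivative of p_0(u) exp(-u^2).\<close>

primrec gauss_poly :: "nat \<Rightarrow> nat \<Rightarrow> complex poly" where
  "gauss_poly n 0 = gauss_antideriv_poly n"
| "gauss_poly n (Suc i) = pderiv (gauss_poly n i) - monom 2 1 * gauss_poly n i"

lemma gauss_antideriv_poly_at_0: "poly (gauss_antideriv_poly n) 0 = - fact n / 2"
  by (induction n) (auto simp: poly_monom)

lemma gauss_poly_1: "gauss_poly n 1 = monom 1 (2*n+1)"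
proof (induction n)
  case 0
  show ?case by (simp add: monom_altdef pderiv_pCons)
next
  case (Suc n)
  have "gauss_poly (Suc n) 1 = pderiv (monom (-1/2) (2*n+2)) - monom 2 1 * monom (-1/2) (2*n+2) +
          smult (of_nat (Suc n)) (gauss_poly n 1)"
    by (simp add: pderiv_add pderiv_smult algebra_simps smult_diff_right)
  also have "\<dots> = monom 1 (2 * Suc n + 1)"
  proof -
    have "pderiv (monom (-1/2 :: complex) (2*n+2)) = - monom (of_nat (Suc n)) (2*n+1)"
      unfolding pderiv_monom minus_monom by (simp add: field_simps)
    moreover have "monom 2 1 * monom (-1/2 :: complex) (2*n+2) = - monom 1 (2 * Suc n + 1)"
      unfolding mult_monom minus_monom by simp
    ultimately show ?thesis unfolding Suc by (simp add: smult_monom)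
  qed
  finally show ?case .
qed

text \<open>The left-hand side is the l-th derivative at 0 of u^(2n+1) exp(-u^2), so it can be read off the
  Taylor series of that function.\<close>

lemma gauss_poly_at_0:
  "poly (gauss_poly n (Suc l)) 0 =
     (if 2*n+1 \<le> l \<and> even (l - (2*n+1))
      then fact l * (-1) ^ ((l - (2*n+1)) div 2) / fact ((l - (2*n+1)) div 2) else 0)"
proof -
  define W :: "complex fps" where
    "W = Abs_fps (\<lambda>k. if even k then (-1) ^ (k div 2) / fact (k div 2) else 0)"
  have W': "fps_deriv W = - (fps_const 2 * (fps_X * W))"
  proof (rule fps_ext)
    fix k
    show "fps_nth (fps_deriv W) k = fps_nth (- (fps_const 2 * (fps_X * W))) k"
    proof (cases "even k")
      case True
      then show ?thesis by (cases "k = 0") (auto simp: W_def mult.assoc)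
    next
      case False
      then obtain j where k: "k = 2 * j + 1" by (auto elim: oddE)
      have "(1 + of_nat j :: complex) \<noteq> 0" using of_nat_neq_0[of j, where 'a = complex] by simp
      then show ?thesis unfolding k by (simp add: W_def mult.assoc divide_simps)
    qed
  qed
  \<comment> \<open>W is the Taylor series of exp(-u^2), so that A i is that of the i-th function of the tower.\<close>
  define A where "A = (\<lambda>i. fps_of_poly (gauss_poly n i) * W)"
  have dA: "fps_deriv (A i) = A (Suc i)" for i
    by (simp add: A_def W' fps_of_poly_diff fps_of_poly_mult fps_of_poly_pderiv[symmetric]
          fps_of_poly_monom algebra_simps)
  have A0: "fps_nth (A i) 0 = poly (gauss_poly n i) 0" for i
    by (simp add: A_def W_def poly_0_coeff_0)
  have "fact l * fps_nth (A i) l = fps_nth (A (i + l)) 0" for i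
  proof (induction l arbitrary: i)
    case (Suc l)
    have "fact (Suc l) * fps_nth (A i) (Suc l) = fact l * fps_nth (A (Suc i)) l"
      unfolding dA[symmetric] by (simp add: algebra_simps)
    with Suc[of "Suc i"] show ?case by simp
  qed simp
  from this[of 1] have "poly (gauss_poly n (Suc l)) 0 = fact l * fps_nth (A 1) l"
    by (simp add: A0)
  also have "A 1 = fps_X ^ (2*n+1) * W"
    unfolding A_def gauss_poly_1 by (simp add: fps_of_poly_monom)
  also have "fps_nth (fps_X ^ (2*n+1) * W) l = (if l < 2*n+1 then 0 else fps_nth W (l - (2*n+1)))"
    by (rule fps_X_power_mult_nth)
  finally show ?thesis by (simp add: W_def)
qed

lemma power_le_fact_mult_exp:
  assumes "u \<ge> (0::real)" shows "u ^ i \<le> fact i * exp u"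
proof -
  have "(\<Sum>k\<in>{i}. u ^ k /\<^sub>R fact k) \<le> (\<Sum>k. u ^ k /\<^sub>R fact k)"
    using assms by (intro sum_le_suminf summable_exp_generic) auto
  then show ?thesis by (simp add: exp_def field_simps)
qed

text \<open>Rapid decay, in the exponential form that turns sums over blocks into geometric series.\<close>

lemma poly_mult_gaussian_bound:
  fixes p :: "complex poly"
  obtains C where "C \<ge> 0" "\<And>u. u \<ge> 0 \<Longrightarrow> norm (poly p (of_real u) * exp (- (of_real u)\<^sup>2)) \<le> C * exp (- u)"
proof (rule that[of "exp 1 * (\<Sum>i\<le>degree p. norm (coeff p i) * fact i)"])
  fix u :: real assume u: "u \<ge> 0"
  have "norm (poly p (of_real u)) \<le> (\<Sum>i\<le>degree p. norm (coeff p i) * (fact i * exp u))"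
    unfolding poly_altdef
    by (intro sum_norm_le)
       (use u power_le_fact_mult_exp in \<open>auto simp: norm_mult norm_power intro!: mult_left_mono\<close>)
  also have "\<dots> = exp u * (\<Sum>i\<le>degree p. norm (coeff p i) * fact i)"
    by (simp add: sum_distrib_left mult_ac)
  finally have 1: "norm (poly p (of_real u)) \<le> \<dots>" .
  have 2: "norm (exp (- (of_real u :: complex)\<^sup>2)) \<le> exp (1 - 2 * u)"
  proof -
    have "norm (exp (- (of_real u :: complex)\<^sup>2)) = exp (- u\<^sup>2)"
      by (simp add: norm_exp_eq_Re)
    \<comment> \<open>this is the estimate u^2 \<ge> 2 u - 1\<close>
    moreover have "(u - 1)\<^sup>2 \<ge> 0" by simp
    ultimately show ?thesis by (simp add: power2_diff)
  qed
  have "norm (poly p (of_real u) * exp (- (of_real u)\<^sup>2)) \<le>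
      (exp u * (\<Sum>i\<le>degree p. norm (coeff p i) * fact i)) * exp (1 - 2 * u)"
    unfolding norm_mult by (intro mult_mono 1 2) (auto intro!: mult_nonneg_nonneg sum_nonneg)
  also have "\<dots> = exp 1 * (\<Sum>i\<le>degree p. norm (coeff p i) * fact i) * (exp u * exp (- 2 * u))"
    by (simp add: exp_diff exp_minus field_simps)
  also have "exp u * exp (- 2 * u) = exp (- u)" by (simp add: exp_add[symmetric])
  finally show "norm (poly p (of_real u) * exp (- (of_real u)\<^sup>2)) \<le>
      exp 1 * (\<Sum>i\<le>degree p. norm (coeff p i) * fact i) * exp (- u)" .
qed (auto intro!: mult_nonneg_nonneg sum_nonneg)

lemma geometric_exp_sum_le:
  assumes "0 < h" "h \<le> (1::real)" "M > 0"
  shows "(\<Sum>k<J. exp (- (h * real (k * M)))) \<le> 2 / h"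
proof -
  have "exp (-h) \<le> 1 - h / 2"
  proof -
    have "exp (-h) \<le> 1 / (1 + h)"
      using exp_ge_add_one_self[of h] assms by (simp add: exp_minus inverse_eq_divide frac_le)
    also have "\<dots> \<le> 1 - h / 2"
    proof -
      have "h * h \<le> h * 1" using assms by (intro mult_left_mono) auto
      then show ?thesis using assms by (simp add: field_simps)
    qed
    finally show ?thesis .
  qed
  then have r: "1 - exp (-h) \<ge> h / 2" "exp (-h) < 1" using assms by auto
  have "(\<Sum>k<J. exp (- (h * real (k * M)))) \<le> (\<Sum>k<J. exp (-h) ^ k)"
  proof (intro sum_mono)
    fix k
    have "real k * 1 \<le> real k * real M" using assms by (intro mult_left_mono) auto
    then have "exp (- (h * real (k * M))) \<le> exp (of_nat k * (-h))"
      using assms by (simp add: mult_ac)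
    then show "exp (- (h * real (k * M))) \<le> exp (-h) ^ k" unfolding exp_of_nat_mult .
  qed
  also have "\<dots> = (1 - exp (-h) ^ J) / (1 - exp (-h))"
    using r by (simp add: sum_gp_strict)
  also have "\<dots> \<le> 1 / (h / 2)"
    using r assms by (intro frac_le) auto
  finally show ?thesis by simp
qed

text \<open>Euler--Maclaurin summation for m^(2n+1) exp(-(h m)^2), started at 0. Each derivative of this function
  of m contributes a factor h, which yields h^(K+1) in the error of a block. Summing over the blocks
  costs a factor 1/h because of the geometric series.\<close>

lemma gaussian_sum_expansion:
  assumes per: "is_period f M" and K: "K > 0"
  obtains C where
    "\<And>h. 0 < h \<Longrightarrow> h \<le> 1 \<Longrightarrow>
       summable (\<lambda>m. f (int (Suc m)) * (of_nat (Suc m) ^ (2*n+1) * exp (- (of_real h * of_nat (Suc m))\<^sup>2)))"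
    "\<And>h. 0 < h \<Longrightarrow> h \<le> 1 \<Longrightarrow>
       norm ((\<Sum>m. f (int (Suc m)) * (of_nat (Suc m) ^ (2*n+1) * exp (- (of_real h * of_nat (Suc m))\<^sup>2)))
         + (\<Sum>i\<le>K. periodic_bernoulli f M i * of_real h ^ i * poly (gauss_poly n i) 0 / of_real h ^ (2*n+2)))
       \<le> C * h ^ K / h ^ (2*n+2)"
proof -
  have M: "M > 0" using per by (simp add: is_period_def)
  define \<beta> where "\<beta> = periodic_bernoulli f M"
  obtain F where F: "F \<ge> 0" "\<And>m. norm (f m) \<le> F" using is_period_bounded[OF per] by blast
  have "\<exists>C\<ge>0. \<forall>u\<ge>0. norm (poly (gauss_poly n i) (of_real u) * exp (- (of_real u)\<^sup>2)) \<le> C * exp (- u)" for i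
    using poly_mult_gaussian_bound by metis
  then obtain c where c: "\<And>i. c i \<ge> 0"
      "\<And>i u. u \<ge> 0 \<Longrightarrow> norm (poly (gauss_poly n i) (of_real u) * exp (- (of_real u)\<^sup>2)) \<le> c i * exp (- u)"
    by metis
  obtain C where C: "C \<ge> 0" and block:
    "\<And>G a B. (\<And>i z. i \<le> K \<Longrightarrow> z \<in> closed_segment a (a + of_nat M) \<Longrightarrow>
                    (G i has_field_derivative G (Suc i) z) (at z)) \<Longrightarrow>
              (\<And>z. z \<in> closed_segment a (a + of_nat M) \<Longrightarrow> norm (G (Suc K) z) \<le> B) \<Longrightarrow>
       norm ((\<Sum>r=1..M. f (int r) * G 1 (a + of_nat r)) -
             (\<Sum>i\<le>K. \<beta> i * (G i (a + of_nat M) - G i a))) \<le> C * B"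
    unfolding \<beta>_def using euler_maclaurin_block[OF M K, of f] by blast
  have main: "summable (\<lambda>m. f (int (Suc m)) * (of_nat (Suc m) ^ (2*n+1) * exp (- (of_real h * of_nat (Suc m))\<^sup>2)))
     \<and>  norm ((\<Sum>m. f (int (Suc m)) * (of_nat (Suc m) ^ (2*n+1) * exp (- (of_real h * of_nat (Suc m))\<^sup>2)))
         + (\<Sum>i\<le>K. \<beta> i * of_real h ^ i * poly (gauss_poly n i) 0 / of_real h ^ (2*n+2)))
       \<le> (2 * C * c (Suc K)) * h ^ K / h ^ (2*n+2)" if h: "0 < h" "h \<le> 1" for h :: real
  proof -
    \<comment> \<open>The normalization makes G 1 the function z^(2n+1) exp(-(h z)^2).\<close>
    define G where "G = (\<lambda>i z. of_real h ^ i / of_real h ^ (2*n+2) *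
                      (poly (gauss_poly n i) (of_real h * z) * exp (- (of_real h * z)\<^sup>2)) :: complex)"
    have G1: "G 1 z = z ^ (2*n+1) * exp (- (of_real h * z)\<^sup>2)" for z
      unfolding G_def gauss_poly_1 using h by (simp add: poly_monom power_mult_distrib)
    have G': "(G i has_field_derivative G (Suc i) z) (at z)" for i z
    proof -
      have "((\<lambda>z. poly (gauss_poly n i) (of_real h * z)) has_field_derivative
              poly (pderiv (gauss_poly n i)) (of_real h * z) * of_real h) (at z)"
        by (rule DERIV_chain2[OF poly_DERIV]) (auto intro!: derivative_eq_intros)
      moreover have "((\<lambda>z. exp (- (of_real h * z)\<^sup>2)) has_field_derivative
              exp (- (of_real h * z)\<^sup>2) * (- (2 * (of_real h * z) * of_real h))) (at z)"
        by (auto intro!: derivative_eq_intros)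
      ultimately have "(G i has_field_derivative of_real h ^ i / of_real h ^ (2*n+2) *
           (poly (pderiv (gauss_poly n i)) (of_real h * z) * of_real h * exp (- (of_real h * z)\<^sup>2) +
            exp (- (of_real h * z)\<^sup>2) * (- (2 * (of_real h * z) * of_real h)) *
              poly (gauss_poly n i) (of_real h * z))) (at z)"
        unfolding G_def by (rule DERIV_cmult[OF DERIV_mult])
      also have "of_real h ^ i / of_real h ^ (2*n+2) *
           (poly (pderiv (gauss_poly n i)) (of_real h * z) * of_real h * exp (- (of_real h * z)\<^sup>2) +
            exp (- (of_real h * z)\<^sup>2) * (- (2 * (of_real h * z) * of_real h)) *
              poly (gauss_poly n i) (of_real h * z)) = G (Suc i) z"
      proof -
        have "a * (p * h' * e + e * (- (2 * u * h')) * q) = (h' * a) * ((p - 2 * u * q) * e)"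
          for a p h' e u q :: complex by (simp add: algebra_simps)
        from this[of "of_real h ^ i / of_real h ^ (2*n+2)"] show ?thesis
          by (simp only: G_def gauss_poly.simps poly_diff poly_mult poly_monom power_one_right
              power_Suc times_divide_eq_right)
      qed
      finally show ?thesis .
    qed
    have Gbd: "norm (G i (of_real y)) \<le> c i * h ^ i / h ^ (2*n+2) * exp (- (h * y))" if "y \<ge> 0" for i y
    proof -
      have "norm (G i (of_real y)) = h ^ i / h ^ (2*n+2) *
          norm (poly (gauss_poly n i) (of_real (h * y)) * exp (- (of_real (h * y))\<^sup>2))"
        unfolding G_def norm_mult[of "_ / _"] using h by (simp add: norm_divide norm_power norm_mult)
      also have "\<dots> \<le> h ^ i / h ^ (2*n+2) * (c i * exp (- (h * y)))"
        using h that by (intro mult_left_mono c) auto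
      finally show ?thesis by (simp add: mult_ac)
    qed
    have summ: "summable (\<lambda>m. f (int (Suc m)) * G 1 (of_nat (Suc m)))"
    proof (rule summable_comparison_test')
      show "summable (\<lambda>m. F * (c 1 * h ^ 1 / h ^ (2*n+2)) * exp (-h) ^ m)"
        using h by (intro summable_mult summable_geometric) auto
      fix m
      have "norm (G 1 (of_nat (Suc m))) \<le> c 1 * h ^ 1 / h ^ (2*n+2) * exp (- (h * real (Suc m)))"
        using Gbd[of "real (Suc m)" 1] by simp
      also have "\<dots> \<le> c 1 * h ^ 1 / h ^ (2*n+2) * exp (of_nat m * (-h))"
        using h c by (intro mult_left_mono) (auto simp: algebra_simps)
      finally have "norm (G 1 (of_nat (Suc m))) \<le> c 1 * h ^ 1 / h ^ (2*n+2) * exp (-h) ^ m"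
        unfolding exp_of_nat_mult .
      then show "norm (f (int (Suc m)) * G 1 (of_nat (Suc m))) \<le> F * (c 1 * h ^ 1 / h ^ (2*n+2)) * exp (-h) ^ m"
        unfolding norm_mult using F mult_mono[of "norm (f (int (Suc m)))" F] by (simp add: mult.assoc)
    qed
    define S where "S = (\<Sum>m. f (int (Suc m)) * G 1 (of_nat (Suc m)))"
    define T where "T = (\<lambda>z. \<Sum>i\<le>K. \<beta> i * G i z)"
    \<comment> \<open>The error of the k-th block; the main terms T telescope to - T 0.\<close>
    define rem where "rem = (\<lambda>k::nat. (\<Sum>r=1..M. f (int r) * G 1 (of_nat (k * M) + of_nat r)) -
             (\<Sum>i\<le>K. \<beta> i * (G i (of_nat (k * M) + of_nat M) - G i (of_nat (k * M)))))"
    have blocks: "(\<lambda>k. \<Sum>r=1..M. f (int r) * G 1 (of_nat (k * M) + of_nat r)) sums S"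
      unfolding S_def by (rule sums_periodic_blocks[OF per summable_sums[OF summ]])
    have rem_bound: "norm (rem k) \<le> C * (c (Suc K) * h ^ Suc K / h ^ (2*n+2) * exp (- (h * real (k * M))))" for k
      unfolding rem_def
    proof (rule block)
      show "(G i has_field_derivative G (Suc i) z) (at z)" for i z by (rule G')
    next
      fix z :: complex assume "z \<in> closed_segment (of_nat (k * M)) (of_nat (k * M) + of_nat M)"
      then have "z \<in> closed_segment (of_real (real (k * M))) (of_real (real (k * M) + real M))" by simp
      then obtain y where y: "z = of_real y" "y \<in> closed_segment (real (k * M)) (real (k * M) + real M)"
        unfolding closed_segment_of_real by blast
      then have "y \<ge> real (k * M)" by (auto simp: closed_segment_eq_real_ivl split: if_splits)
      then have y': "y \<ge> 0" "h * real (k * M) \<le> h * y"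
        using h of_nat_0_le_iff[of "k * M", where 'a = real] by (linarith, intro mult_left_mono) auto
      have "norm (G (Suc K) z) \<le> c (Suc K) * h ^ Suc K / h ^ (2*n+2) * exp (- (h * y))"
        unfolding y using y' by (intro Gbd)
      also have "\<dots> \<le> c (Suc K) * h ^ Suc K / h ^ (2*n+2) * exp (- (h * real (k * M)))"
        using y' c h by (intro mult_left_mono) auto
      finally show "norm (G (Suc K) z) \<le> \<dots>" .
    qed
    have rem_sum: "(\<Sum>k<J. rem k) = (\<Sum>k<J. \<Sum>r=1..M. f (int r) * G 1 (of_nat (k * M) + of_nat r)) -
                     (T (of_real (real (J * M))) - T 0)" for J
    proof (induction J)
      case (Suc J)
      have "rem J = (\<Sum>r=1..M. f (int r) * G 1 (of_nat (J * M) + of_nat r)) -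
              (T (of_real (real (Suc J * M))) - T (of_real (real (J * M))))"
        by (simp add: rem_def T_def algebra_simps sum_subtractf)
      with Suc show ?case by simp
    qed simp
    have "(\<lambda>J. T (of_real (real (J * M)))) \<longlonglongrightarrow> (\<Sum>i\<le>K. \<beta> i * 0)"
      unfolding T_def
    proof (intro tendsto_intros)
      fix i
      show "(\<lambda>J. G i (of_real (real (J * M)))) \<longlonglongrightarrow> 0"
      proof (rule Lim_null_comparison)
        show "\<forall>\<^sub>F J in sequentially. norm (G i (of_real (real (J * M)))) \<le>
                c i * h ^ i / h ^ (2*n+2) * exp (- (h * real (J * M)))"
          by (intro always_eventually allI Gbd) auto
        have "filterlim (\<lambda>J. (h * real M) * real J) at_top sequentially"
          by (rule filterlim_tendsto_pos_mult_at_top[OF tendsto_const _ filterlim_real_sequentially])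
             (use h M in auto)
        then have "filterlim (\<lambda>J. - (h * real (J * M))) at_bot sequentially"
          by (simp add: filterlim_uminus_at_bot mult_ac)
        then have "(\<lambda>J. exp (- (h * real (J * M)))) \<longlonglongrightarrow> 0"
          by (rule filterlim_compose[OF exp_at_bot])
        then show "(\<lambda>J. c i * h ^ i / h ^ (2*n+2) * exp (- (h * real (J * M)))) \<longlonglongrightarrow> 0"
          by (rule tendsto_mult_right_zero)
      qed
    qed
    with blocks have "(\<lambda>J. \<Sum>k<J. rem k) \<longlonglongrightarrow> S - (0 - T 0)"
      unfolding rem_sum sums_def by (intro tendsto_intros) auto
    then have "norm (S - (0 - T 0)) \<le> C * (c (Suc K) * h ^ Suc K / h ^ (2*n+2)) * (2 / h)"
    proof (rule Lim_bounded[OF tendsto_norm], intro allI impI)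
      fix J
      have "norm (\<Sum>k<J. rem k) \<le> (\<Sum>k<J. C * (c (Suc K) * h ^ Suc K / h ^ (2*n+2) * exp (- (h * real (k * M)))))"
        by (rule sum_norm_le) (rule rem_bound)
      also have "\<dots> = C * (c (Suc K) * h ^ Suc K / h ^ (2*n+2)) * (\<Sum>k<J. exp (- (h * real (k * M))))"
        by (simp add: sum_distrib_left mult.assoc)
      also have "\<dots> \<le> C * (c (Suc K) * h ^ Suc K / h ^ (2*n+2)) * (2 / h)"
        using h c C M by (intro mult_left_mono geometric_exp_sum_le) auto
      finally show "norm (\<Sum>k<J. rem k) \<le> \<dots>" .
    qed
    moreover have "C * (c (Suc K) * h ^ Suc K / h ^ (2*n+2)) * (2 / h) = (2 * C * c (Suc K)) * h ^ K / h ^ (2*n+2)"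
      using h by (simp add: field_simps)
    moreover have "T 0 = (\<Sum>i\<le>K. \<beta> i * of_real h ^ i * poly (gauss_poly n i) 0 / of_real h ^ (2*n+2))"
      by (simp add: T_def G_def mult_ac)
    ultimately show ?thesis
      using summ unfolding S_def G1 by simp
  qed
  show ?thesis
    by (rule that[of "2 * C * c (Suc K)"]) (use main in \<open>auto simp: \<beta>_def\<close>)
qed

section \<open>Continuation of periodic Dirichlet series\<close>

lemma neg_of_nat_neq_1: "- of_nat k \<noteq> (1 :: complex)"
proof
  assume "- of_nat k = (1::complex)"
  then have "Re (- of_nat k) = Re 1" by (rule arg_cong)
  then show False by simp
qed

text \<open>The coefficient in the i-th derivative of z^(1-s) / (1-s). The division contributes the pole of the
  continued series at s = 1; at that point itself the value is 0 by convention.\<close>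

definition powr_coeff :: "complex \<Rightarrow> nat \<Rightarrow> complex" where
  "powr_coeff s i = (\<Prod>l<i. 1 - s - of_nat l) / (1 - s)"

text \<open>The derivatives of z^(1-s) / (1-s), so that index 1 is z^(-s).\<close>

definition powr_tower :: "complex \<Rightarrow> nat \<Rightarrow> complex \<Rightarrow> complex" where
  "powr_tower s i z = powr_coeff s i * z powr (1 - s - of_nat i)"

lemma powr_coeff_Suc: "powr_coeff s (Suc i) = (1 - s - of_nat i) * powr_coeff s i"
  by (simp add: powr_coeff_def)

lemma powr_coeff_1: "s \<noteq> 1 \<Longrightarrow> powr_coeff s 1 = 1"
  by (simp add: powr_coeff_def)

lemma powr_tower_1: "s \<noteq> 1 \<Longrightarrow> powr_tower s 1 z = z powr (- s)"
  unfolding powr_tower_def powr_coeff_1 by simp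

lemma powr_tower_deriv:
  assumes "z \<notin> \<real>\<^sub>\<le>\<^sub>0"
  shows "(powr_tower s i has_field_derivative powr_tower s (Suc i) z) (at z)"
proof -
  have "(powr_tower s i has_field_derivative
           powr_coeff s i * ((1 - s - of_nat i) * z powr (1 - s - of_nat i - 1))) (at z)"
    unfolding powr_tower_def
    by (intro DERIV_cmult has_field_derivative_powr assms)
  then show ?thesis by (simp add: powr_tower_def powr_coeff_Suc mult_ac diff_diff_eq add_ac)
qed

lemma norm_powr_tower:
  assumes "y > 0"
  shows "norm (powr_tower s i (of_real y)) = norm (powr_coeff s i) * y powr (1 - Re s - real i)"
  using assms by (simp add: powr_tower_def norm_mult norm_powr_real_powr)

lemma powr_coeff_holomorphic: "(\<lambda>s. powr_coeff s i) holomorphic_on - {1}"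
  unfolding powr_coeff_def by (intro holomorphic_intros) auto

lemma powr_tower_holomorphic: "(\<lambda>s. powr_tower s i z) holomorphic_on - {1}"
  unfolding powr_tower_def by (intro holomorphic_intros powr_coeff_holomorphic)

text \<open>The error of the Euler--Maclaurin formula for z^(-s) on the block that starts at (k+1) M. The block
  that starts at 0 is left out because z^(-s) is singular there.\<close>

definition em_remainder :: "(int \<Rightarrow> complex) \<Rightarrow> nat \<Rightarrow> nat \<Rightarrow> complex \<Rightarrow> nat \<Rightarrow> complex" where
  "em_remainder f M K s k =
     (\<Sum>r=1..M. f (int r) * powr_tower s 1 (of_nat (Suc k * M) + of_nat r)) -
     (\<Sum>i\<le>K. periodic_bernoulli f M i *
        (powr_tower s i (of_nat (Suc k * M) + of_nat M) - powr_tower s i (of_nat (Suc k * M))))"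

text \<open>The Euler--Maclaurin formula read as a definition: the terms of the first block are summed
  directly, the telescoped main terms leave their value at M, and the error series
  is still convergent for Re s > 1 - K.\<close>

definition em_continuation :: "(int \<Rightarrow> complex) \<Rightarrow> nat \<Rightarrow> nat \<Rightarrow> complex \<Rightarrow> complex" where
  "em_continuation f M K s =
     (\<Sum>r=1..M. f (int r) * of_nat r powr (- s)) -
     (\<Sum>i\<le>K. periodic_bernoulli f M i * powr_tower s i (of_nat M)) +
     (\<Sum>k. em_remainder f M K s k)"

lemma em_remainder_bound:
  assumes "M > 0" "K > 0"
  obtains C where "C \<ge> 0"
    "\<And>s k. Re s + real K \<ge> 0 \<Longrightarrow> norm (em_remainder f M K s k) \<le>
       C * (norm (powr_coeff s (Suc K)) * real (Suc k) powr (- Re s - real K))"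
proof -
  obtain C where C: "C \<ge> 0" and block:
    "\<And>G a B. (\<And>i z. i \<le> K \<Longrightarrow> z \<in> closed_segment a (a + of_nat M) \<Longrightarrow>
                    (G i has_field_derivative G (Suc i) z) (at z)) \<Longrightarrow>
              (\<And>z. z \<in> closed_segment a (a + of_nat M) \<Longrightarrow> norm (G (Suc K) z) \<le> B) \<Longrightarrow>
       norm ((\<Sum>r=1..M. f (int r) * G 1 (a + of_nat r)) -
             (\<Sum>i\<le>K. periodic_bernoulli f M i * (G i (a + of_nat M) - G i a))) \<le> C * B"
    using euler_maclaurin_block[OF assms, of f] by blast
  show ?thesis
  proof (rule that[OF C])
    fix s k assume s: "Re s + real K \<ge> 0"
    have seg: "\<exists>y. z = of_real y \<and> y \<ge> real (Suc k)"
      if "z \<in> closed_segment (of_nat (Suc k * M)) (of_nat (Suc k * M) + of_nat M)" for z :: complex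
    proof -
      have "z \<in> closed_segment (of_real (real (Suc k * M))) (of_real (real (Suc k * M) + real M))"
        using that by simp
      then obtain y where y: "z = of_real y" "y \<in> closed_segment (real (Suc k * M)) (real (Suc k * M) + real M)"
        unfolding closed_segment_of_real by blast
      then have "y \<ge> real (Suc k * M)"
        unfolding closed_segment_eq_real_ivl by (auto split: if_splits)
      moreover have "real (Suc k * M) \<ge> real (Suc k)" unfolding of_nat_le_iff using assms by (cases M) auto
      ultimately show ?thesis using y by (intro exI[of _ y]) linarith
    qed
    show "norm (em_remainder f M K s k) \<le>
       C * (norm (powr_coeff s (Suc K)) * real (Suc k) powr (- Re s - real K))"
      unfolding em_remainder_def
    proof (rule block)
      fix i z assume "z \<in> closed_segment (of_nat (Suc k * M)) (of_nat (Suc k * M) + of_nat M :: complex)"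
      then obtain y where "z = of_real y" "y \<ge> real (Suc k)" using seg by blast
      then show "(powr_tower s i has_field_derivative powr_tower s (Suc i) z) (at z)"
        by (intro powr_tower_deriv) (auto simp: complex_nonpos_Reals_iff)
    next
      fix z assume "z \<in> closed_segment (of_nat (Suc k * M)) (of_nat (Suc k * M) + of_nat M :: complex)"
      then obtain y where y: "z = of_real y" "y \<ge> real (Suc k)" using seg by blast
      then have "norm (powr_tower s (Suc K) z) =
          norm (powr_coeff s (Suc K)) * y powr (1 - Re s - real (Suc K))"
        by (simp only: y norm_powr_tower[of y] less_le_trans[of 0 "real (Suc k)" y] of_nat_0_less_iff zero_less_Suc)
      also have "1 - Re s - real (Suc K) = - Re s - real K" by simp
      also have "y powr (- Re s - real K) \<le> real (Suc k) powr (- Re s - real K)"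
        using y s by (intro powr_mono2') auto
      finally show "norm (powr_tower s (Suc K) z) \<le>
          norm (powr_coeff s (Suc K)) * real (Suc k) powr (- Re s - real K)"
        by (simp add: mult_left_mono)
    qed
  qed
qed

lemma em_continuation_holomorphic:
  assumes "M > 0" "K > 0"
  shows "em_continuation f M K holomorphic_on ({s. Re s > 1 - real K} - {1})"
proof -
  let ?S = "{s. Re s > 1 - real K} - {1::complex}"
  obtain C where C: "C \<ge> 0" and bound:
    "\<And>s k. Re s + real K \<ge> 0 \<Longrightarrow> norm (em_remainder f M K s k) \<le>
       C * (norm (powr_coeff s (Suc K)) * real (Suc k) powr (- Re s - real K))"
    using em_remainder_bound[OF assms, of f] by blast
  have "(\<lambda>s. \<Sum>k. em_remainder f M K s k) holomorphic_on ?S"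
  proof (rule holomorphic_uniform_sequence)
    show "open ?S" by (intro open_Diff open_halfspace_Re_gt) auto
    show "(\<lambda>s. \<Sum>k<n. em_remainder f M K s k) holomorphic_on ?S" for n
      unfolding em_remainder_def
      by (intro holomorphic_intros holomorphic_on_subset[OF powr_tower_holomorphic]) auto
    fix s0 assume s0: "s0 \<in> ?S"
    define \<delta> where "\<delta> = (Re s0 + real K - 1) / 2"
    define d where "d = min \<delta> (dist s0 1 / 2)"
    have \<delta>: "\<delta> > 0" using s0 by (simp add: \<delta>_def)
    have d: "d > 0" "d \<le> \<delta>" "d \<le> dist s0 1 / 2" using s0 \<delta> by (auto simp: d_def)
    have ball: "Re s + real K \<ge> 1 + \<delta> \<and> s \<noteq> 1" if "s \<in> cball s0 d" for s
    proof
      have "\<bar>Re (s0 - s)\<bar> \<le> norm (s0 - s)" by (rule abs_Re_le_cmod)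
      with that d show "Re s + real K \<ge> 1 + \<delta>" by (auto simp: dist_norm \<delta>_def field_simps)
      show "s \<noteq> 1" using that d by auto
    qed
    have "compact ((\<lambda>s. powr_coeff s (Suc K)) ` cball s0 d)"
      by (intro compact_continuous_image compact_cball holomorphic_on_imp_continuous_on
            holomorphic_on_subset[OF powr_coeff_holomorphic]) (use ball in auto)
    then obtain B where B: "\<And>s. s \<in> cball s0 d \<Longrightarrow> norm (powr_coeff s (Suc K)) \<le> B"
      using compact_imp_bounded bounded_iff by (metis imageI)
    have "B \<ge> 0" using B[of s0] d norm_ge_zero order_trans by (metis centre_in_cball less_imp_le)
    have "uniform_limit (cball s0 d) (\<lambda>n s. \<Sum>k<n. em_remainder f M K s k)
            (\<lambda>s. \<Sum>k. em_remainder f M K s k) sequentially"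
    proof (rule Weierstrass_m_test)
      show "summable (\<lambda>k. C * (B * real (Suc k) powr (- 1 - \<delta>)))"
      proof (intro summable_mult)
        have "summable (\<lambda>k. real k powr (- 1 - \<delta>))" using \<delta> by (simp add: summable_real_powr_iff)
        then show "summable (\<lambda>k. real (Suc k) powr (- 1 - \<delta>))" by (subst summable_Suc_iff)
      qed
      fix k s assume s: "s \<in> cball s0 d"
      have "norm (em_remainder f M K s k) \<le>
          C * (norm (powr_coeff s (Suc K)) * real (Suc k) powr (- Re s - real K))"
        using ball[OF s] \<delta> by (intro bound) auto
      also have "\<dots> \<le> C * (B * real (Suc k) powr (- 1 - \<delta>))"
        using ball[OF s] \<open>B \<ge> 0\<close> by (intro mult_left_mono mult_mono B s C powr_mono) auto
      finally show "norm (em_remainder f M K s k) \<le> \<dots>" .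
    qed
    moreover have "cball s0 d \<subseteq> ?S" using ball \<delta> by fastforce
    ultimately show "\<exists>d>0. cball s0 d \<subseteq> ?S \<and> uniform_limit (cball s0 d)
         (\<lambda>n s. \<Sum>k<n. em_remainder f M K s k) (\<lambda>s. \<Sum>k. em_remainder f M K s k) sequentially"
      using d by blast
  qed
  moreover have "(\<lambda>s. (\<Sum>r=1..M. f (int r) * of_nat r powr (- s)) -
     (\<Sum>i\<le>K. periodic_bernoulli f M i * powr_tower s i (of_nat M))) holomorphic_on ?S"
    by (intro holomorphic_intros holomorphic_on_subset[OF powr_tower_holomorphic]) auto
  ultimately show ?thesis
    unfolding em_continuation_def by (intro holomorphic_on_add)
qed

text \<open>For Re s > 1 all functions of the tower tend to 0 at infinity, so the telescoping is complete and
  the value at M is the only main term.\<close>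

lemma em_continuation_Dirichlet_series:
  assumes per: "is_period f M" and s: "Re s > 1"
  shows "(\<lambda>k. f (int (Suc k)) * of_nat (Suc k) powr (- s)) sums em_continuation f M K s"
proof -
  have M: "M > 0" using per by (simp add: is_period_def)
  have s1: "s \<noteq> 1" using s by auto
  obtain F where F: "F \<ge> 0" "\<And>m. norm (f m) \<le> F" using is_period_bounded[OF per] by blast
  have "summable (\<lambda>k. f (int (Suc k)) * of_nat (Suc k) powr (- s))"
  proof (rule summable_comparison_test')
    have "summable (\<lambda>k. real k powr (- Re s))" using s by (simp add: summable_real_powr_iff)
    then have "summable (\<lambda>k. real (Suc k) powr (- Re s))" by (subst summable_Suc_iff)
    then show "summable (\<lambda>k. F * real (Suc k) powr (- Re s))" by (rule summable_mult)
    fix k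
    have "norm (of_real (real (Suc k)) powr (- s)) = real (Suc k) powr (- Re s)"
      by (subst norm_powr_real_powr) auto
    then show "norm (f (int (Suc k)) * of_nat (Suc k) powr (- s)) \<le> F * real (Suc k) powr (- Re s)"
      unfolding norm_mult using F by (simp add: mult_right_mono)
  qed
  then obtain S where S: "(\<lambda>k. f (int (Suc k)) * of_nat (Suc k) powr (- s)) sums S"
    by (auto simp: summable_def)
  define block where "block = (\<lambda>k. \<Sum>r=1..M. f (int r) * powr_tower s 1 (of_nat (k * M) + of_nat r))"
  have "block sums S"
    unfolding block_def powr_tower_1[OF s1] by (rule sums_periodic_blocks[OF per S])
  then have "(\<lambda>k. block (Suc k)) sums (S - block 0)"
    by (simp add: sums_Suc_iff)
  then have lim1: "(\<lambda>J. \<Sum>k<J. block (Suc k)) \<longlonglongrightarrow> S - block 0" by (simp add: sums_def)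
  define T where "T = (\<lambda>z. \<Sum>i\<le>K. periodic_bernoulli f M i * powr_tower s i z)"
  have rem_sum: "(\<Sum>k<J. em_remainder f M K s k) = (\<Sum>k<J. block (Suc k)) -
                   (T (of_real (real (Suc J * M))) - T (of_nat M))" for J
  proof (induction J)
    case (Suc J)
    have "em_remainder f M K s J = block (Suc J) -
            (T (of_real (real (Suc (Suc J) * M))) - T (of_real (real (Suc J * M))))"
      by (simp add: em_remainder_def block_def T_def algebra_simps sum_subtractf)
    with Suc show ?case by simp
  qed simp
  have lim2: "(\<lambda>J. T (of_real (real (Suc J * M)))) \<longlonglongrightarrow> (\<Sum>i\<le>K. periodic_bernoulli f M i * 0)"
    unfolding T_def
  proof (intro tendsto_intros)
    fix i
    have "filterlim (\<lambda>J. real M * real J) at_top sequentially"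
      by (rule filterlim_tendsto_pos_mult_at_top[OF tendsto_const _ filterlim_real_sequentially])
         (use M in auto)
    then have "filterlim (\<lambda>J. real M * real (Suc J)) at_top sequentially"
      by (subst filterlim_sequentially_Suc)
    then have "filterlim (\<lambda>J. real (Suc J * M)) at_top sequentially" by (simp only: of_nat_mult mult.commute)
    then have "(\<lambda>J. real (Suc J * M) powr (1 - Re s - real i)) \<longlonglongrightarrow> 0"
      by (rule tendsto_neg_powr[rotated]) (use s in auto)
    then have "(\<lambda>J. norm (powr_coeff s i) * real (Suc J * M) powr (1 - Re s - real i)) \<longlonglongrightarrow> 0"
      by (rule tendsto_mult_right_zero)
    moreover have "norm (powr_tower s i (of_real (real (Suc J * M)))) =
        norm (powr_coeff s i) * real (Suc J * M) powr (1 - Re s - real i)" for J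
      by (rule norm_powr_tower) (use M in \<open>simp only: of_nat_0_less_iff nat_0_less_mult_iff zero_less_Suc\<close>)
    ultimately show "(\<lambda>J. powr_tower s i (of_real (real (Suc J * M)))) \<longlonglongrightarrow> 0"
      by (subst tendsto_norm_zero_iff[symmetric]) simp
  qed
  have "(\<lambda>J. \<Sum>k<J. em_remainder f M K s k) \<longlonglongrightarrow> (S - block 0) - ((\<Sum>i\<le>K. periodic_bernoulli f M i * 0) - T (of_nat M))"
    unfolding rem_sum by (intro tendsto_intros lim1 lim2)
  then have "(\<Sum>k. em_remainder f M K s k) = S - block 0 + T (of_nat M)"
    by (intro sums_unique[symmetric]) (simp add: sums_def)
  moreover have "block 0 = (\<Sum>r=1..M. f (int r) * of_nat r powr (- s))"
    unfolding block_def powr_tower_1[OF s1] by simp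
  ultimately have "em_continuation f M K s = S"
    by (simp add: em_continuation_def T_def)
  with S show ?thesis by simp
qed

text \<open>At s = -k the tower consists of derivatives of a polynomial and breaks off, so all remainders vanish.
  For the same reason the formula is also exact on the first block, from 0 to M. There
  it moves the main terms from M to 0, where only the constant polynomial H (k+1) survives.\<close>

lemma em_continuation_at_neg_nat:
  assumes per: "is_period f M"
  shows "em_continuation f M (k + 2) (- of_nat k) = - fact k * periodic_bernoulli f M (Suc k)"
proof -
  have M: "M > 0" using per by (simp add: is_period_def)
  have k2: "k + 2 > 0" by simp
  let ?s = "- of_nat k :: complex"
  have s1: "?s \<noteq> 1" by (rule neg_of_nat_neq_1)
  have coeff_0: "powr_coeff ?s i = 0" if "i \<ge> k + 2" for i
  proof -
    have "(\<Prod>l<i. 1 - ?s - of_nat l) = 0" by (rule prod_zero) (use that in \<open>auto intro!: bexI[of _ "k+1"]\<close>)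
    then show ?thesis by (simp add: powr_coeff_def)
  qed
  obtain C where "C \<ge> 0" and "\<And>s j. Re s + real (k+2) \<ge> 0 \<Longrightarrow> norm (em_remainder f M (k+2) s j) \<le>
       C * (norm (powr_coeff s (Suc (k+2))) * real (Suc j) powr (- Re s - real (k+2)))"
    using em_remainder_bound[OF M k2, of f] by blast
  from this(2)[of ?s] have "em_remainder f M (k+2) ?s j = 0" for j
    by (simp add: coeff_0)
  then have rem0: "(\<Sum>j. em_remainder f M (k+2) ?s j) = 0" by simp
  \<comment> \<open>The same tower with ordinary powers, which are differentiable at 0 as well. The truncated
     exponent for i > k + 1 is harmless because the coefficient is then 0.\<close>
  define H where "H = (\<lambda>i z. powr_coeff ?s i * z ^ (k + 1 - i))"
  obtain C where "C \<ge> 0" and block: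
    "\<And>G a B. (\<And>i z. i \<le> k+2 \<Longrightarrow> z \<in> closed_segment a (a + of_nat M) \<Longrightarrow>
                    (G i has_field_derivative G (Suc i) z) (at z)) \<Longrightarrow>
              (\<And>z. z \<in> closed_segment a (a + of_nat M) \<Longrightarrow> norm (G (Suc (k+2)) z) \<le> B) \<Longrightarrow>
       norm ((\<Sum>r=1..M. f (int r) * G 1 (a + of_nat r)) -
             (\<Sum>i\<le>k+2. periodic_bernoulli f M i * (G i (a + of_nat M) - G i a))) \<le> C * B"
    using euler_maclaurin_block[OF M k2, of f] by blast
  have "norm ((\<Sum>r=1..M. f (int r) * H 1 (0 + of_nat r)) -
             (\<Sum>i\<le>k+2. periodic_bernoulli f M i * (H i (0 + of_nat M) - H i 0))) \<le> C * 0"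
  proof (rule block)
    fix i z
    show "(H i has_field_derivative H (Suc i) z) (at z)"
    proof (cases "i \<le> k + 1")
      case True
      have "(H i has_field_derivative powr_coeff ?s i * (of_nat (k + 1 - i) * z ^ (k + 1 - i - 1))) (at z)"
        unfolding H_def by (auto intro!: derivative_eq_intros)
      also have "powr_coeff ?s i * (of_nat (k + 1 - i) * z ^ (k + 1 - i - 1)) = H (Suc i) z"
        using True by (simp add: H_def powr_coeff_Suc of_nat_diff)
      finally show ?thesis .
    next
      case False
      then show ?thesis by (simp add: H_def coeff_0)
    qed
  next
    show "norm (H (Suc (k+2)) z) \<le> 0" for z by (simp add: H_def coeff_0)
  qed
  then have exact: "(\<Sum>r=1..M. f (int r) * H 1 (of_nat r)) =
             (\<Sum>i\<le>k+2. periodic_bernoulli f M i * (H i (of_nat M) - H i 0))"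
    by simp
  have "(\<Sum>r=1..M. f (int r) * of_nat r powr (- ?s)) = (\<Sum>r=1..M. f (int r) * H 1 (of_nat r))"
    unfolding H_def powr_coeff_1[OF s1] by (intro sum.cong) (auto simp: powr_nat)
  moreover have "powr_tower ?s i (of_nat M) = H i (of_nat M)" for i
  proof (cases "i \<le> k + 1")
    case True
    then have "1 - ?s - of_nat i = of_nat (k + 1 - i)" by (simp add: of_nat_diff)
    then show ?thesis using M by (simp add: powr_tower_def H_def powr_nat del: of_nat_diff)
  qed (simp add: powr_tower_def H_def coeff_0)
  ultimately have "em_continuation f M (k + 2) ?s = - (\<Sum>i\<le>k+2. periodic_bernoulli f M i * H i 0)"
    unfolding em_continuation_def rem0 exact by (simp add: ring_distribs sum_subtractf)
  also have "(\<Sum>i\<le>k+2. periodic_bernoulli f M i * H i 0) = (\<Sum>i\<in>{k+1}. periodic_bernoulli f M i * H i 0)"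
    by (rule sum.mono_neutral_right) (auto simp: H_def coeff_0 power_0_left)
  also have "\<dots> = periodic_bernoulli f M (k+1) * H (k+1) 0" by simp
  also have "H (k+1) 0 = fact k"
  proof -
    have "(\<Prod>l<k+1. 1 - ?s - of_nat l) = (\<Prod>l<k+1. of_nat (k + 1 - l))"
      by (intro prod.cong) (auto simp: of_nat_diff)
    also have "\<dots> = of_nat (\<Prod>l<k+1. k + 1 - l)" by simp
    also have "(\<Prod>l<k+1. k + 1 - l) = fact (k + 1)"
      by (simp only: fact_prod_rev lessThan_atLeast0 of_nat_id)
    finally have num: "(\<Prod>l<k+1. 1 - ?s - of_nat l) = (1 + of_nat k) * fact k"
      by (simp add: ring_distribs)
    have "(1 + of_nat k :: complex) \<noteq> 0" using of_nat_neq_0[of k, where 'a = complex] by simp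
    then show ?thesis unfolding H_def powr_coeff_def num by simp
  qed
  finally show ?thesis by simp
qed

text \<open>The formulas for different K agree by the identity theorem and are glued along the half-planes.\<close>

theorem periodic_Dirichlet_series_continuation:
  assumes per: "is_period f M"
  obtains F where "continues_Dirichlet_series f F"
    "\<And>k. F (- of_nat k) = - fact k * periodic_bernoulli f M (Suc k)"
proof -
  have M: "M > 0" using per by (simp add: is_period_def)
  define dom where "dom = (\<lambda>K::nat. {s. Re s > 1 - real K} - {1::complex})"
  have open_dom: "open (dom K)" for K
    unfolding dom_def by (intro open_Diff open_halfspace_Re_gt) auto
  have agree: "em_continuation f M K s = em_continuation f M K' s"
    if "K > 0" "K \<le> K'" "s \<in> dom K" for K K' s
  proof -
    have "em_continuation f M K s - em_continuation f M K' s = 0"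
    proof (rule analytic_continuation[of
          "\<lambda>s. em_continuation f M K s - em_continuation f M K' s" "dom K" "{s. Re s > 1}" 2])
      show "(\<lambda>s. em_continuation f M K s - em_continuation f M K' s) holomorphic_on dom K"
        using that M by (intro holomorphic_on_diff holomorphic_on_subset[OF em_continuation_holomorphic])
                        (auto simp: dom_def)
      show "connected (dom K)"
        unfolding dom_def
        by (intro connected_open_delete open_halfspace_Re_gt convex_connected convex_halfspace_Re_gt) simp
      show "(2::complex) islimpt {s. Re s > 1}"
        by (rule interior_limit_point) (simp add: interior_open open_halfspace_Re_gt)
      show "em_continuation f M K z - em_continuation f M K' z = 0" if "z \<in> {s. Re s > 1}" for z
        using sums_unique2[OF em_continuation_Dirichlet_series[OF per, of z K]
            em_continuation_Dirichlet_series[OF per, of z K']] that by simp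
    qed (use that open_dom in \<open>auto simp: dom_def\<close>)
    then show ?thesis by simp
  qed
  \<comment> \<open>Any K with 1 - K < Re s would do here.\<close>
  define idx where "idx = (\<lambda>s. nat \<lceil>2 - Re s\<rceil> + 1)"
  have idx: "idx s > 0" "Re s > 1 - real (idx s)" for s
  proof -
    have "real (nat \<lceil>2 - Re s\<rceil>) \<ge> 2 - Re s" by (rule real_nat_ceiling_ge)
    then show "Re s > 1 - real (idx s)" by (simp add: idx_def)
  qed (simp add: idx_def)
  define F where "F = (\<lambda>s. em_continuation f M (idx s) s)"
  have F: "F s = em_continuation f M K s" if "K > 0" "s \<in> dom K" for K s
  proof (cases "K \<le> idx s")
    case True
    then show ?thesis unfolding F_def using agree[OF that(1) True that(2)] by simp
  next
    case False
    have "s \<in> dom (idx s)" using that idx(2)[of s] by (simp add: dom_def)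
    with False show ?thesis unfolding F_def using agree[OF idx(1), of s K s] by simp
  qed
  show ?thesis
  proof (rule that[of F])
    show "continues_Dirichlet_series f F"
      unfolding continues_Dirichlet_series_def
    proof
      show "F holomorphic_on - {1}"
        unfolding holomorphic_on_def
      proof
        fix s assume "s \<in> - {1::complex}"
        then have s: "s \<in> dom (idx s)" using idx by (auto simp: dom_def)
        have "F holomorphic_on dom (idx s)"
          using em_continuation_holomorphic[OF M idx(1)[of s], of f] F[OF idx(1)]
            holomorphic_cong[of "dom (idx s)" "dom (idx s)" F "em_continuation f M (idx s)"]
          unfolding dom_def by blast
        then have "F field_differentiable (at s)"
          using s open_dom holomorphic_on_imp_differentiable_at by blast
        then show "F field_differentiable (at s within - {1})"
          by (rule field_differentiable_at_within)
      qed
      show "\<forall>s. Re s > 1 \<longrightarrow> (\<lambda>k. f (int (Suc k)) * of_nat (Suc k) powr (- s)) sums F s"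
        unfolding F_def using em_continuation_Dirichlet_series[OF per] by blast
    qed
    fix k
    have "F (- of_nat k) = em_continuation f M (k + 2) (- of_nat k)"
    proof (rule F)
      have "- of_nat k \<noteq> (1::complex)" by (rule neg_of_nat_neq_1)
      then show "- of_nat k \<in> dom (k + 2)" by (simp add: dom_def)
    qed simp
    also have "\<dots> = - fact k * periodic_bernoulli f M (Suc k)"
      by (rule em_continuation_at_neg_nat[OF per])
    finally show "F (- of_nat k) = - fact k * periodic_bernoulli f M (Suc k)" .
  qed
qed

lemma L_fun_neg_nat:
  assumes "is_period f M"
  shows "L_fun (- of_nat k) f = - fact k * periodic_bernoulli f M (Suc k)"
proof -
  obtain F where F: "continues_Dirichlet_series f F"
      "\<And>k. F (- of_nat k) = - fact k * periodic_bernoulli f M (Suc k)"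
    using periodic_Dirichlet_series_continuation[OF assms] by blast
  then show ?thesis using L_fun_unique[OF F(1) neg_of_nat_neq_1] by simp
qed

section \<open>Discrete Fourier transform\<close>

text \<open>The additive characters of the integers modulo L.\<close>

definition unity_char :: "nat \<Rightarrow> int \<Rightarrow> complex" where
  "unity_char L m = cis (2 * pi * of_int m / of_nat L)"

lemma unity_char_add: "unity_char L (a + b) = unity_char L a * unity_char L b"
  by (simp add: unity_char_def cis_mult add_divide_distrib ring_distribs)

lemma unity_char_0 [simp]: "unity_char L 0 = 1"
  by (simp add: unity_char_def)

lemma norm_unity_char [simp]: "norm (unity_char L a) = 1"
  by (simp add: unity_char_def)

lemma unity_char_mult_inverse: "unity_char L a * unity_char L (- a) = 1"
  by (simp add: unity_char_add[symmetric])

lemma unity_char_power: "unity_char L a ^ n = unity_char L (a * int n)"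
  unfolding unity_char_def Complex.DeMoivre by (simp add: mult_ac)

lemma unity_char_powi: "unity_char L a powi n = unity_char L (a * n)"
  by (simp add: unity_char_def cis_power_int mult_ac)

lemma unity_char_eq_1_iff:
  assumes "L > 0"
  shows "unity_char L m = 1 \<longleftrightarrow> int L dvd m"
proof
  assume "int L dvd m"
  then obtain k where "m = int L * k" by blast
  then have "2 * pi * of_int m / of_nat L = 2 * pi * of_int k" using assms by simp
  then show "unity_char L m = 1" unfolding unity_char_def by (metis Ints_of_int cis_multiple_2pi)
next
  assume "unity_char L m = 1"
  then have "cos (2 * pi * of_int m / of_nat L) = 1"
    unfolding unity_char_def by (metis cis.sel(1) one_complex.sel(1))
  then obtain x :: int where "2 * pi * of_int m / of_nat L = of_int x * 2 * pi"
    using cos_one_2pi_int by blast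
  then have "real_of_int m = of_int (x * int L)" using assms by (simp add: field_simps)
  then have "m = x * int L" by (subst (asm) of_int_eq_iff)
  then show "int L dvd m" by simp
qed

lemma sum_unity_char:
  assumes "L > 0"
  shows "(\<Sum>j<L. unity_char L (int j * m)) = (if int L dvd m then of_nat L else 0)"
proof -
  have "(\<Sum>j<L. unity_char L (int j * m)) = (\<Sum>j<L. unity_char L m ^ j)"
    by (simp add: unity_char_power mult.commute)
  also have "\<dots> = (if int L dvd m then of_nat L else 0)"
  proof (cases "int L dvd m")
    case True
    then show ?thesis using unity_char_eq_1_iff[OF assms, of m] by simp
  next
    case False
    then have "unity_char L m \<noteq> 1" using unity_char_eq_1_iff[OF assms, of m] by simp
    moreover have "unity_char L m ^ L = 1"
      unfolding unity_char_power using unity_char_eq_1_iff[OF assms] by simp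
    ultimately show ?thesis using False by (simp add: geometric_sum)
  qed
  finally show ?thesis .
qed

definition dft :: "(int \<Rightarrow> complex) \<Rightarrow> nat \<Rightarrow> int \<Rightarrow> complex" where
  "dft f L j = (\<Sum>r=1..L. f (int r) * unity_char L (- (j * int r)))"

lemma dft_inversion:
  assumes "1 \<le> r" "r \<le> L"
  shows "(\<Sum>j<L. dft f L (int j) * unity_char L (int j * int r)) = of_nat L * f (int r)"
proof -
  have L: "L > 0" using assms by simp
  have "(\<Sum>j<L. dft f L (int j) * unity_char L (int j * int r)) =
        (\<Sum>j<L. \<Sum>r'=1..L. f (int r') * unity_char L (int j * (int r - int r')))"
    unfolding dft_def sum_distrib_right
    by (intro sum.cong refl) (simp add: mult.assoc unity_char_add[symmetric] algebra_simps)
  also have "\<dots> = (\<Sum>r'=1..L. f (int r') * (\<Sum>j<L. unity_char L (int j * (int r - int r'))))"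
    by (subst sum.swap) (simp add: sum_distrib_left)
  also have "\<dots> = (\<Sum>r'=1..L. if r' = r then of_nat L * f (int r) else 0)"
  proof (intro sum.cong refl)
    fix r' assume r': "r' \<in> {1..L}"
    have "int L dvd (int r - int r') \<longleftrightarrow> r' = r"
    proof
      assume "int L dvd (int r - int r')"
      moreover have "\<bar>int r - int r'\<bar> < int L" using r' assms by auto
      ultimately show "r' = r" using zdvd_not_zless[of "\<bar>int r - int r'\<bar>" "int L"] by force
    qed simp
    then show "f (int r') * (\<Sum>j<L. unity_char L (int j * (int r - int r'))) =
        (if r' = r then of_nat L * f (int r) else 0)"
      using sum_unity_char[OF L] by simp
  qed
  also have "\<dots> = of_nat L * f (int r)" using assms by simp
  finally show ?thesis .
qed

text \<open>The index runs over 1..L, so shifting it by one replaces one summand by another that is equal by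
  periodicity.\<close>

lemma sum_periodic_shift:
  assumes per: "is_period g L"
  shows "(\<Sum>r=1..L. g (int r + d)) = (\<Sum>r=1..L. g (int r))"
proof -
  have step: "(\<Sum>r=1..L. g (int r + (d + 1))) = (\<Sum>r=1..L. g (int r + d))" for d
  proof -
    have "(\<Sum>r=1..L. g (int r + (d + 1))) + g (1 + d) = (\<Sum>r=1..L. g (int r + d)) + g (int L + (1 + d))"
      by (induction L) (auto simp: algebra_simps)
    moreover have "g (int L + (1 + d)) = g (1 + d)"
      using per unfolding is_period_def by (metis add.commute)
    ultimately show ?thesis by (metis add_right_cancel)
  qed
  show ?thesis
  proof (induction d rule: int_induct[where k = 0])
    case (step1 i)
    then show ?case using step[of i] by simp
  next
    case (step2 i)
    then show ?case using step[of "i - 1"] by simp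
  qed simp
qed

lemma sum_periodic_reflect:
  assumes per: "is_period g L"
  shows "(\<Sum>r=1..L. g (- int r)) = (\<Sum>r=1..L. g (int r))"
proof -
  have "(\<Sum>r=1..L. g (- int r)) = (\<Sum>r=1..L. g (int r + (- 1 - int L)))"
    by (rule sum.reindex_bij_witness[of _ "\<lambda>r. L + 1 - r" "\<lambda>r. L + 1 - r"]) (auto simp: of_nat_diff)
  then show ?thesis using sum_periodic_shift[OF per] by simp
qed

lemma unity_char_mult_period: "L > 0 \<Longrightarrow> unity_char L (m + int L * a) = unity_char L m"
  using unity_char_eq_1_iff[of L "int L * a"] by (simp add: unity_char_add)

lemma is_period_mult_unity_char:
  assumes "is_period f L"
  shows "is_period (\<lambda>r. f r * unity_char L (j * r)) L"
proof -
  have "unity_char L (j * (r + int L)) = unity_char L (j * r)" for r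
    using assms unity_char_mult_period[of L "j * r" j] by (simp add: is_period_def algebra_simps)
  then show ?thesis using assms by (simp add: is_period_def)
qed

text \<open>Translating f multiplies its transform by a character. In this form it will be applied to chirps,
  for which a translate is again a multiple of f by a character.\<close>

lemma dft_shift:
  assumes per: "is_period f L"
  shows "dft f L j = (\<Sum>r=1..L. f (int r + d) * unity_char L (- (j * int r))) * unity_char L (- (j * d))"
proof -
  have char: "unity_char L (- j * (int r + d)) = unity_char L (- (j * int r)) * unity_char L (- (j * d))" for r
    by (simp add: unity_char_add[symmetric] algebra_simps)
  have "dft f L j = (\<Sum>r=1..L. f (int r + d) * unity_char L (- j * (int r + d)))"
    using sum_periodic_shift[OF is_period_mult_unity_char[OF per, of "- j"], of d]
    by (simp add: dft_def)
  then show ?thesis unfolding char by (simp add: sum_distrib_right mult.assoc)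
qed

lemma dft_even:
  assumes per: "is_period f L" and ev: "\<And>r. f (- r) = f r"
  shows "dft f L (int L - j) = dft f L j"
proof -
  have L: "L > 0" using per by (simp add: is_period_def)
  have "unity_char L (- ((int L - j) * r)) = unity_char L (j * r)" for r
    using unity_char_mult_period[OF L, of "j * r" "- r"] by (simp add: algebra_simps)
  then have "dft f L (int L - j) = (\<Sum>r=1..L. f (int r) * unity_char L (j * int r))"
    by (simp add: dft_def)
  also have "\<dots> = (\<Sum>r=1..L. f (- int r) * unity_char L (j * (- int r)))"
    by (rule sum_periodic_reflect[OF is_period_mult_unity_char[OF per], symmetric])
  also have "\<dots> = dft f L j" by (simp add: dft_def ev)
  finally show ?thesis .
qed

section \<open>Functional equation at negative odd integers\<close>

text \<open>The logarithmic derivative of the reflection formula of the Gamma function.\<close>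

lemma Digamma_reflection:
  fixes z :: complex
  assumes "z \<notin> \<int>"
  shows "Digamma (1 - z) - Digamma z = of_real pi * cot (of_real pi * z)"
proof -
  have z: "z \<notin> \<int>\<^sub>\<le>\<^sub>0" "1 - z \<notin> \<int>\<^sub>\<le>\<^sub>0"
    using assms nonpos_Ints_Int by (blast, metis Ints_1 Ints_diff diff_diff_eq2 add_diff_cancel_left' nonpos_Ints_Int)
  have "((\<lambda>z. rGamma z * rGamma (1 - z)) has_field_derivative
          rGamma z * rGamma (1 - z) * (Digamma (1 - z) - Digamma z)) (at z)"
    using z by (auto intro!: derivative_eq_intros simp: algebra_simps)
  moreover have "((\<lambda>z. rGamma z * rGamma (1 - z)) has_field_derivative cos (of_real pi * z)) (at z)"
    unfolding rGamma_reflection_complex by (auto intro!: derivative_eq_intros)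
  ultimately have eq: "sin (of_real pi * z) / of_real pi * (Digamma (1 - z) - Digamma z) = cos (of_real pi * z)"
    unfolding rGamma_reflection_complex by (rule DERIV_unique)
  have "rGamma z * rGamma (1 - z) \<noteq> 0" using z by (simp add: rGamma_eq_zero_iff)
  then have "sin (of_real pi * z) \<noteq> 0" by (simp add: rGamma_reflection_complex)
  with eq show ?thesis by (simp add: cot_def field_simps)
qed

text \<open>The left-hand side is (1 - \<i> cot (\<pi> u)) / 2.\<close>

lemma one_over_one_minus_exp:
  assumes "u \<notin> \<int>"
  shows "inverse (1 - exp (- (2 * of_real pi * \<i> * u))) =
           1/2 - \<i> / (2 * of_real pi) * (Digamma (1 - u) - Digamma u)"
proof -
  let ?v = "of_real pi * u"
  let ?E = "exp (\<i> * ?v)"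
  have "rGamma u * rGamma (1 - u) \<noteq> 0"
    using assms nonpos_Ints_Int
    by (auto simp: rGamma_eq_zero_iff)
  then have s: "sin ?v \<noteq> 0" by (simp add: rGamma_reflection_complex)
  have "sin ?v = (?E - exp (- (\<i> * ?v))) / (2 * \<i>)" by (simp add: sin_exp_eq)
  moreover have "cos ?v = (?E + exp (- (\<i> * ?v))) / 2" by (simp add: cos_exp_eq)
  moreover have "exp (- (2 * of_real pi * \<i> * u)) = exp (- (\<i> * ?v)) * exp (- (\<i> * ?v))"
  proof -
    have "- (2 * of_real pi * \<i> * u) = - (\<i> * ?v) + - (\<i> * ?v)" by simp
    then show ?thesis by (simp only: exp_add)
  qed
  moreover have "exp (- (\<i> * ?v)) = inverse ?E" by (rule exp_minus)
  ultimately have sc: "sin ?v = (?E - inverse ?E) / (2 * \<i>)" "cos ?v = (?E + inverse ?E) / 2"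
      "exp (- (2 * of_real pi * \<i> * u)) = inverse ?E * inverse ?E" by simp_all
  have E: "?E \<noteq> 0" by simp
  have aux: "inverse (1 - inverse E * inverse E) = 1/2 - \<i> / 2 * (((E + inverse E) / 2) / ((E - inverse E) / (2 * \<i>)))"
    if "E \<noteq> 0" "(E - inverse E) / (2 * \<i>) \<noteq> 0" for E :: complex
  proof -
    have nz: "E * E - 1 \<noteq> 0" using that by (auto simp: field_simps)
    have "inverse (1 - inverse E * inverse E) = E * E / (E * E - 1)"
      using that(1) nz by (simp add: field_simps)
    moreover have "((E + inverse E) / 2) / ((E - inverse E) / (2 * \<i>)) = \<i> * (E * E + 1) / (E * E - 1)"
      using that(1) nz by (simp add: field_simps)
    moreover have "E * E / (E * E - 1) = 1/2 - \<i> / 2 * (\<i> * (E * E + 1) / (E * E - 1))"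
      using nz by (simp add: field_simps)
    ultimately show ?thesis by simp
  qed
  have "inverse (1 - exp (- (2 * of_real pi * \<i> * u))) = 1/2 - \<i> / 2 * (cos ?v / sin ?v)"
    unfolding sc by (rule aux[OF E]) (use s sc in simp)
  also have "\<dots> = 1/2 - \<i> / (2 * of_real pi) * (Digamma (1 - u) - Digamma u)"
    unfolding Digamma_reflection[OF assms] cot_def by simp
  finally show ?thesis .
qed

text \<open>Only exponents that arise by differentiating the digamma function occur, so s is a natural number.\<close>

definition hurwitz_zeta :: "nat \<Rightarrow> real \<Rightarrow> real" where
  "hurwitz_zeta s a = (\<Sum>i. 1 / (a + real i) ^ s)"

lemma hurwitz_zeta_sums:
  assumes "k > 0" "a > 0"
  shows "(\<lambda>i. 1 / (a + real i) ^ Suc k) sums hurwitz_zeta (Suc k) a"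
  using Polygamma_LIMSEQ[of a k] assms
  by (simp add: hurwitz_zeta_def inverse_eq_divide sums_iff)

lemma Polygamma_odd_eq_hurwitz_zeta:
  assumes "odd k" "a > 0"
  shows "Polygamma k (of_real a :: complex) = fact k * of_real (hurwitz_zeta (Suc k) a)"
proof -
  have "k > 0" using assms odd_pos by blast
  then have "(\<lambda>i. inverse ((of_real a + of_nat i) ^ Suc k)) sums (Polygamma k (of_real a :: complex) / fact k)"
    using Polygamma_LIMSEQ[of "of_real a :: complex" k] assms by simp
  moreover have "(\<lambda>i. of_real (1 / (a + real i) ^ Suc k)) sums (of_real (hurwitz_zeta (Suc k) a) :: complex)"
    by (rule sums_of_real) (rule hurwitz_zeta_sums[OF \<open>k > 0\<close> assms(2)])
  ultimately have "Polygamma k (of_real a :: complex) / fact k = of_real (hurwitz_zeta (Suc k) a)"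
    using sums_unique2 by (fastforce simp: inverse_eq_divide)
  then show ?thesis by (simp add: field_simps)
qed

text \<open>Differentiating the digamma form k times produces polygamma functions, which are Hurwitz zeta values.
  For odd k the contributions of \<theta> and 1 - \<theta> have the same sign.\<close>

lemma one_over_one_minus_exp_coeff:
  fixes \<theta> :: real
  assumes k: "odd k" and \<theta>: "0 < \<theta>" "\<theta> < 1"
  shows "fps_nth (inverse (1 - fps_const (cis (- (2 * pi * \<theta>))) * fps_exp (-1))) k =
           \<i> / (2 * of_real pi) * (- \<i> / (2 * of_real pi)) ^ k *
           of_real (hurwitz_zeta (Suc k) \<theta> + hurwitz_zeta (Suc k) (1 - \<theta>))"
proof -
  define \<tau> :: complex where "\<tau> = - \<i> / (2 * of_real pi)"
  define u where "u = (\<lambda>z. of_real \<theta> + \<tau> * z)"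
  define h where "h = (\<lambda>z. inverse (1 - exp (- (2 * of_real pi * \<i> * u z))))"
  \<comment> \<open>D i is the i-th derivative of h up to the additive constant 1/2, which is lost for i > 0.\<close>
  define D where "D = (\<lambda>i z. \<tau> ^ i * \<tau> * ((-1) ^ i * Polygamma i (1 - u z) - Polygamma i (u z)))"
  have not_int: "\<theta> \<noteq> of_int n" for n
  proof
    assume "\<theta> = of_int n"
    then have "0 < n" "n < 1" using \<theta> by auto
    then show False by simp
  qed
  have \<theta>_Int: "complex_of_real \<theta> \<notin> \<int>"
  proof
    assume "complex_of_real \<theta> \<in> \<int>"
    then obtain n where "complex_of_real \<theta> = of_int n" by (elim Ints_cases)
    then have "Re (complex_of_real \<theta>) = Re (of_int n)" by (rule arg_cong)
    then show False using not_int by simp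
  qed
  have w: "cis (- (2 * pi * \<theta>)) \<noteq> 1"
  proof
    assume "cis (- (2 * pi * \<theta>)) = 1"
    then have "cos (- (2 * pi * \<theta>)) = 1" by (metis cis.sel(1) one_complex.sel(1))
    then obtain x :: int where "- (2 * pi * \<theta>) = of_int x * 2 * pi"
      using cos_one_2pi_int by blast
    then have "2 * pi * (\<theta> - of_int (- x)) = 0" by (simp add: algebra_simps)
    then have "\<theta> = of_int (- x)" by simp
    then show False using not_int by blast
  qed
  have exp_u: "exp (- (2 * of_real pi * \<i> * u z)) = cis (- (2 * pi * \<theta>)) * exp (- 1 * z)" for z
  proof -
    have "- (2 * of_real pi * \<i> * u z) = \<i> * of_real (- (2 * pi * \<theta>)) + (- 1 * z)"
      by (simp add: u_def \<tau>_def ring_distribs)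
    then show ?thesis by (simp only: cis_conv_exp exp_add)
  qed
  have "h has_fps_expansion inverse (1 - fps_const (cis (- (2 * pi * \<theta>))) * fps_exp (-1))"
    unfolding h_def exp_u using w by (intro fps_expansion_intros) auto
  then have nth: "fps_nth (inverse (1 - fps_const (cis (- (2 * pi * \<theta>))) * fps_exp (-1))) k =
      (deriv ^^ k) h 0 / fact k" by (rule fps_nth_fps_expansion)
  define U where "U = u -` (- \<int>)"
  have "open U" unfolding U_def u_def by (intro open_vimage open_Compl closed_Ints continuous_intros)
  have "0 \<in> U" using \<theta>_Int by (simp add: U_def u_def)
  have DD: "(D i has_field_derivative D (Suc i) z) (at z)" if "z \<in> U" for i z
  proof -
    have nonpos: "u z \<notin> \<int>\<^sub>\<le>\<^sub>0" "1 - u z \<notin> \<int>\<^sub>\<le>\<^sub>0"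
      using that nonpos_Ints_Int unfolding U_def
      by (blast, metis ComplD vimageD Ints_1 Ints_diff diff_diff_eq2 add_diff_cancel_left' nonpos_Ints_Int)
    have u': "(u has_field_derivative \<tau>) (at z)" unfolding u_def by (auto intro!: derivative_eq_intros)
    have "((\<lambda>z. Polygamma i (u z)) has_field_derivative Polygamma (Suc i) (u z) * \<tau>) (at z)"
      by (rule DERIV_chain2[OF has_field_derivative_Polygamma[OF nonpos(1)] u'])
    moreover have "((\<lambda>z. Polygamma i (1 - u z)) has_field_derivative Polygamma (Suc i) (1 - u z) * (0 - \<tau>)) (at z)"
      by (rule DERIV_chain2[OF has_field_derivative_Polygamma[OF nonpos(2)] DERIV_diff[OF DERIV_const u']])
    ultimately have "(D i has_field_derivative \<tau> ^ i * \<tau> *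
        ((-1) ^ i * (Polygamma (Suc i) (1 - u z) * (0 - \<tau>)) - Polygamma (Suc i) (u z) * \<tau>)) (at z)"
      unfolding D_def by (intro DERIV_cmult DERIV_diff)
    also have "\<tau> ^ i * \<tau> * ((-1) ^ i * (Polygamma (Suc i) (1 - u z) * (0 - \<tau>)) - Polygamma (Suc i) (u z) * \<tau>) = D (Suc i) z"
      by (simp add: D_def algebra_simps)
    finally show ?thesis .
  qed
  have h_eq: "h z = 1/2 + D 0 z" if "z \<in> U" for z
    using one_over_one_minus_exp[of "u z"] that by (simp add: h_def D_def \<tau>_def U_def)
  have deriv_h: "(deriv ^^ Suc i) h z = D (Suc i) z" if "z \<in> U" for i z
    using that
  proof (induction i arbitrary: z)
    case 0
    have "eventually (\<lambda>z. h z = 1/2 + D 0 z) (nhds z)"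
      using eventually_nhds_in_open[OF \<open>open U\<close> 0] by eventually_elim (rule h_eq)
    then have "deriv h z = deriv (\<lambda>z. 1/2 + D 0 z) z" by (rule deriv_cong_ev) simp
    also have "\<dots> = 0 + D (Suc 0) z"
      by (intro DERIV_imp_deriv DERIV_add DERIV_const DD 0)
    finally show ?case by simp
  next
    case (Suc i)
    have "eventually (\<lambda>z. (deriv ^^ Suc i) h z = D (Suc i) z) (nhds z)"
      using eventually_nhds_in_open[OF \<open>open U\<close> Suc.prems] by eventually_elim (rule Suc.IH)
    then have "deriv ((deriv ^^ Suc i) h) z = deriv (D (Suc i)) z" by (rule deriv_cong_ev) simp
    also have "\<dots> = D (Suc (Suc i)) z" by (intro DERIV_imp_deriv DD Suc.prems)
    finally show ?case by simp
  qed
  obtain i where i: "k = Suc i" using k by (cases k) auto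
  have "(deriv ^^ k) h 0 = D k 0" unfolding i by (rule deriv_h[OF \<open>0 \<in> U\<close>])
  also have "\<dots> = \<tau> ^ k * \<tau> * (- Polygamma k (of_real (1 - \<theta>)) - Polygamma k (of_real \<theta>))"
    using k by (simp add: D_def u_def)
  also have "\<dots> = \<tau> ^ k * \<tau> * (- (fact k * of_real (hurwitz_zeta (Suc k) (1 - \<theta>))) - fact k * of_real (hurwitz_zeta (Suc k) \<theta>))"
    using \<theta> by (subst (1 2) Polygamma_odd_eq_hurwitz_zeta[OF k]) auto
  finally show ?thesis
    unfolding nth by (simp add: \<tau>_def field_simps)
qed

lemma fps_const_sum: "fps_const (\<Sum>x\<in>A. g x) = (\<Sum>x\<in>A. fps_const (g x))"
  by (rule fps_ext) (simp add: fps_sum_nth)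

text \<open>Expanding f in characters splits the generating function into geometric sums of unity_char L j * e^z,
  and the factor e^(L z) - 1 cancels. The frequency j = 0 has to be absent: it would contribute a pole
  at z = 0.\<close>

lemma periodic_bernoulli_dft:
  assumes L: "L > 0" and mean0: "dft f L 0 = 0"
  shows "of_nat L * periodic_bernoulli f L (Suc k) =
           (\<Sum>j\<in>{0<..<L}. dft f L (int j) *
              fps_nth (inverse (1 - fps_const (unity_char L (- int j)) * fps_exp (-1))) k)"
proof -
  define H where "H = (\<lambda>j. inverse (1 - fps_const (unity_char L (- int j)) * fps_exp (-1)))"
  define q where "q = (\<lambda>j. fps_const (unity_char L (int j)) * fps_exp 1)"
  have q_power: "q j ^ r = fps_const (unity_char L (int j * int r)) * fps_exp (of_nat r)" for j r
    by (simp add: q_def power_mult_distrib fps_const_power unity_char_power fps_exp_power_mult)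
  have geom: "(\<Sum>r=1..L. q j ^ r) = (fps_exp (of_nat L) - 1) * H j" if j: "j \<in> {0<..<L}" for j
  proof -
    have "\<not> int L dvd - int j" using j by (auto dest: zdvd_imp_le)
    then have "unity_char L (- int j) \<noteq> 1" using unity_char_eq_1_iff[OF L] by blast
    then have inv: "H j * (1 - fps_const (unity_char L (- int j)) * fps_exp (-1)) = 1"
      unfolding H_def by (intro inverse_mult_eq_1) simp
    have "(fps_const (unity_char L (int j)) * fps_const (unity_char L (- int j))) * (fps_exp 1 * fps_exp (-1)) = 1"
      by (simp add: unity_char_mult_inverse fps_exp_add_mult[symmetric])
    then have qinv: "q j * (fps_const (unity_char L (- int j)) * fps_exp (-1)) = 1"
      by (simp add: q_def mult_ac)
    have "(\<Sum>r=1..L. q j ^ r) * (1 - fps_const (unity_char L (- int j)) * fps_exp (-1)) =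
          (\<Sum>r=1..L. q j ^ r - q j ^ (r - 1))"
      unfolding sum_distrib_right
    proof (intro sum.cong refl)
      fix r assume "r \<in> {1..L}"
      then have "q j ^ r = q j ^ (r - 1) * q j" by (cases r) auto
      then show "q j ^ r * (1 - fps_const (unity_char L (- int j)) * fps_exp (-1)) = q j ^ r - q j ^ (r - 1)"
        using qinv by (simp add: ring_distribs mult.assoc)
    qed
    also have "\<dots> = q j ^ L - 1"
      using L by (induction L rule: nat_induct_non_zero) auto
    also have "q j ^ L = fps_exp (of_nat L)"
      using unity_char_eq_1_iff[OF L, of "int j * int L"] by (simp add: q_power)
    finally have telescoped: "(\<Sum>r=1..L. q j ^ r) * (1 - fps_const (unity_char L (- int j)) * fps_exp (-1)) =
        fps_exp (of_nat L) - 1" .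
    have inv': "(1 - fps_const (unity_char L (- int j)) * fps_exp (-1)) * H j = 1"
      using inv by (simp only: mult.commute[of _ "H j"])
    have "(\<Sum>r=1..L. q j ^ r) =
        (\<Sum>r=1..L. q j ^ r) * (1 - fps_const (unity_char L (- int j)) * fps_exp (-1)) * H j"
      by (simp only: mult.assoc inv' mult_1_right)
    then show ?thesis by (simp only: telescoped)
  qed
  have "fps_const (of_nat L) * (\<Sum>r=1..L. fps_const (f (int r)) * fps_exp (of_nat r)) =
        (\<Sum>r=1..L. \<Sum>j<L. fps_const (dft f L (int j)) * q j ^ r)"
    unfolding sum_distrib_left
  proof (intro sum.cong refl)
    fix r assume "r \<in> {1..L}"
    then have "of_nat L * f (int r) = (\<Sum>j<L. dft f L (int j) * unity_char L (int j * int r))"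
      using dft_inversion[of r L f] by simp
    then have "fps_const (of_nat L * f (int r)) * fps_exp (of_nat r) =
       (\<Sum>j<L. fps_const (dft f L (int j) * unity_char L (int j * int r)) * fps_exp (of_nat r))"
      by (simp only: fps_const_sum sum_distrib_right)
    then show "fps_const (of_nat L) * (fps_const (f (int r)) * fps_exp (of_nat r)) =
        (\<Sum>j<L. fps_const (dft f L (int j)) * q j ^ r)"
      unfolding q_power by (simp add: mult.assoc[symmetric])
  qed
  also have "\<dots> = (\<Sum>j<L. fps_const (dft f L (int j)) * (\<Sum>r=1..L. q j ^ r))"
    by (subst sum.swap) (simp only: sum_distrib_left)
  also have "\<dots> = (\<Sum>j\<in>{0<..<L}. fps_const (dft f L (int j)) * (\<Sum>r=1..L. q j ^ r))"
  proof (rule sum.mono_neutral_right)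
    show "\<forall>i\<in>{..<L} - {0<..<L}. fps_const (dft f L (int i)) * (\<Sum>r=1..L. q i ^ r) = 0"
    proof
      fix i assume "i \<in> {..<L} - {0<..<L}"
      then have "i = 0" by auto
      then show "fps_const (dft f L (int i)) * (\<Sum>r=1..L. q i ^ r) = 0" using mean0 by simp
    qed
  qed auto
  also have "\<dots> = (\<Sum>j\<in>{0<..<L}. (fps_exp (of_nat L) - 1) * (fps_const (dft f L (int j)) * H j))"
  proof (intro sum.cong refl)
    fix j assume j: "j \<in> {0<..<L}"
    show "fps_const (dft f L (int j)) * (\<Sum>r=1..L. q j ^ r) =
            (fps_exp (of_nat L) - 1) * (fps_const (dft f L (int j)) * H j)"
      unfolding geom[OF j] by (rule mult.left_commute)
  qed
  also have "\<dots> = (fps_exp (of_nat L) - 1) * (\<Sum>j\<in>{0<..<L}. fps_const (dft f L (int j)) * H j)"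
    by (rule sum_distrib_left[symmetric])
  finally have 1: "fps_const (of_nat L) * (\<Sum>r=1..L. fps_const (f (int r)) * fps_exp (of_nat r)) = \<dots>" .
  have "(fps_exp (of_nat L) - 1) * (fps_const (of_nat L) * periodic_bernoulli_fps f L) =
        fps_X * (fps_const (of_nat L) * (\<Sum>r=1..L. fps_const (f (int r)) * fps_exp (of_nat r)))"
    using periodic_bernoulli_fps_eq[OF L, of f] by (simp add: mult_ac)
  also have "\<dots> = (fps_exp (of_nat L) - 1) * (fps_X * (\<Sum>j\<in>{0<..<L}. fps_const (dft f L (int j)) * H j))"
    unfolding 1 by (simp add: mult_ac)
  finally have 2: "(fps_exp (of_nat L) - 1) * (fps_const (of_nat L) * periodic_bernoulli_fps f L) = \<dots>" .
  have "fps_nth (fps_exp (of_nat L) - 1 :: complex fps) 1 \<noteq> 0" using L by simp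
  then have "fps_exp (of_nat L) - 1 \<noteq> (0 :: complex fps)" by (metis fps_zero_nth)
  with 2 have "fps_const (of_nat L) * periodic_bernoulli_fps f L =
      fps_X * (\<Sum>j\<in>{0<..<L}. fps_const (dft f L (int j)) * H j)"
    by (simp only: mult_cancel_left) auto
  then have "fps_nth (fps_const (of_nat L) * periodic_bernoulli_fps f L) (Suc k) =
      fps_nth (fps_X * (\<Sum>j\<in>{0<..<L}. fps_const (dft f L (int j)) * H j)) (Suc k)" by simp
  then show ?thesis by (simp add: fps_sum_nth H_def)
qed

section \<open>A criterion for nonvanishing\<close>

text \<open>Compare (2b+1)^2 with 4b(b+1), whose reciprocals telescope. The precise constant is
  irrelevant as long as it is below 2, twice the term b = 0.\<close>

lemma sum_odd_inverse_powers_le: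
  assumes "s \<ge> 2"
  shows "(\<Sum>b<n. 1 / (2 * real b + 1) ^ s) \<le> 5 / 4"
proof -
  have step: "(\<Sum>b<Suc n. 1 / (2 * real b + 1) ^ s) \<le> 5 / 4 - 1 / (4 * (real n + 1))" for n
  proof (induction n)
    case (Suc n)
    have "(2 * real (Suc n) + 1) ^ 2 \<le> (2 * real (Suc n) + 1) ^ s"
      using assms by (intro power_increasing) auto
    moreover have "4 * (real n + 1) * (real n + 2) \<le> (2 * real (Suc n) + 1) ^ 2"
      by (simp add: power2_eq_square algebra_simps)
    ultimately have "4 * (real n + 1) * (real n + 2) \<le> (2 * real (Suc n) + 1) ^ s" by linarith
    then have "1 / (2 * real (Suc n) + 1) ^ s \<le> 1 / (4 * (real n + 1) * (real n + 2))"
      by (rule divide_left_mono) (auto intro!: mult_pos_pos zero_less_power add_nonneg_pos)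
    also have "\<dots> = 1 / (4 * (real n + 1)) - 1 / (4 * (real (Suc n) + 1))"
      by (simp add: divide_simps)
    finally show ?case using Suc by simp
  qed simp
  show ?thesis
  proof (cases n)
    case (Suc m)
    have "5 / 4 - 1 / (4 * (real m + 1)) \<le> 5 / 4" by simp
    with step[of m] show ?thesis unfolding Suc by linarith
  qed simp
qed

text \<open>For the odd residues j modulo L, the terms of the Hurwitz zeta functions at j/L are together the
  terms (L / j)^(k+1) for all odd j \<ge> 1.\<close>

lemma sum_hurwitz_zeta_odd_le:
  assumes k: "k > 0" and L: "L = 2 * m" "m > 0"
  shows "(\<Sum>a<m. hurwitz_zeta (Suc k) ((2 * real a + 1) / real L)) \<le> 5 / 4 * real L ^ Suc k"
proof -
  have "(\<lambda>i. \<Sum>a<m. 1 / ((2 * real a + 1) / real L + real i) ^ Suc k) sums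
          (\<Sum>a<m. hurwitz_zeta (Suc k) ((2 * real a + 1) / real L))"
    using L by (intro sums_sum hurwitz_zeta_sums k) auto
  then have "(\<lambda>n. \<Sum>i<n. \<Sum>a<m. 1 / ((2 * real a + 1) / real L + real i) ^ Suc k) \<longlonglongrightarrow>
          (\<Sum>a<m. hurwitz_zeta (Suc k) ((2 * real a + 1) / real L))"
    by (simp only: sums_def)
  then show ?thesis
  proof (rule Lim_bounded, intro allI impI)
    fix n
    define g where "g = (\<lambda>b. real L ^ Suc k * (1 / (2 * real b + 1) ^ Suc k))"
    have "(\<Sum>a<m. 1 / ((2 * real a + 1) / real L + real i) ^ Suc k) = (\<Sum>b=i*m..<i*m+m. g b)" for i
    proof -
      have "(\<Sum>b=i*m..<i*m+m. g b) = (\<Sum>a<m. g (i * m + a))"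
        by (rule sum.reindex_bij_witness[of _ "\<lambda>a. i * m + a" "\<lambda>b. b - i * m"]) auto
      also have "\<dots> = (\<Sum>a<m. 1 / ((2 * real a + 1) / real L + real i) ^ Suc k)"
      proof (intro sum.cong refl)
        fix a
        have "(2 * real a + 1) / real L + real i = (2 * real (i * m + a) + 1) / real L"
          using L by (simp add: field_simps)
        then show "g (i * m + a) = 1 / ((2 * real a + 1) / real L + real i) ^ Suc k"
          by (simp only: g_def power_divide) simp
      qed
      finally show ?thesis by simp
    qed
    then have "(\<Sum>i<n. \<Sum>a<m. 1 / ((2 * real a + 1) / real L + real i) ^ Suc k) = (\<Sum>b<n*m. g b)"
      by (simp add: sum.nat_group)
    also have "\<dots> = real L ^ Suc k * (\<Sum>b<n*m. 1 / (2 * real b + 1) ^ Suc k)"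
      by (simp only: g_def sum_distrib_left)
    also have "\<dots> \<le> real L ^ Suc k * (5 / 4)"
      using k by (intro mult_left_mono sum_odd_inverse_powers_le) auto
    finally show "(\<Sum>i<n. \<Sum>a<m. 1 / ((2 * real a + 1) / real L + real i) ^ Suc k) \<le> 5 / 4 * real L ^ Suc k"
      by simp
  qed
qed

text \<open>Up to a nonzero factor, the coefficient is the sum of the transform at j times the Hurwitz zeta value
  at j/L. All transforms that occur have the same absolute value c, so if the sum vanished,
  the term j = 1 would be at most as large as the others together, and the Hurwitz zeta values at
  odd j would add up to at least 2 L^(k+1), which contradicts the bound 5/4 L^(k+1).\<close>

theorem periodic_bernoulli_nonzero:
  fixes f :: "int \<Rightarrow> complex"
  assumes k: "odd k" and L: "L = 2 * m" "m > 0"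
    and even_zero: "\<And>j. even j \<Longrightarrow> dft f L j = 0"
    and sym: "\<And>j. dft f L (int L - j) = dft f L j"
    and const: "\<And>j. odd j \<Longrightarrow> norm (dft f L j) = c" and c: "c > 0"
  shows "periodic_bernoulli f L (Suc k) \<noteq> 0"
proof -
  have L0: "L > 0" and k0: "k > 0" using L k odd_pos by auto
  define Z where "Z = (\<lambda>j::nat. hurwitz_zeta (Suc k) (real j / real L))"
  define \<kappa> :: complex where "\<kappa> = \<i> / (2 * of_real pi) * (- \<i> / (2 * of_real pi)) ^ k"
  define d where "d = (\<lambda>j::nat. dft f L (int j))"
  have "\<kappa> \<noteq> 0" by (simp add: \<kappa>_def)
  have d0: "dft f L 0 = 0" by (rule even_zero) simp
  have coeff: "fps_nth (inverse (1 - fps_const (unity_char L (- int j)) * fps_exp (-1))) k =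
      \<kappa> * of_real (Z j + Z (L - j))" if "j \<in> {0<..<L}" for j
  proof -
    have "1 - real j / real L = real (L - j) / real L"
      using that L0 by (simp add: field_simps of_nat_diff)
    then show ?thesis
      using one_over_one_minus_exp_coeff[OF k, of "real j / real L"] that
      by (simp add: unity_char_def \<kappa>_def Z_def)
  qed
  have "of_nat L * periodic_bernoulli f L (Suc k) = (\<Sum>j\<in>{0<..<L}. d j * (\<kappa> * of_real (Z j + Z (L - j))))"
    unfolding periodic_bernoulli_dft[OF L0 d0] d_def by (intro sum.cong refl) (simp add: coeff)
  also have "\<dots> = \<kappa> * ((\<Sum>j\<in>{0<..<L}. d j * of_real (Z j)) + (\<Sum>j\<in>{0<..<L}. d j * of_real (Z (L - j))))"
    by (simp add: sum_distrib_left sum.distrib[symmetric] algebra_simps)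
  \<comment> \<open>reflecting j uses that the transform of an even function is even\<close>
  also have "(\<Sum>j\<in>{0<..<L}. d j * of_real (Z (L - j))) = (\<Sum>j\<in>{0<..<L}. d j * of_real (Z j))"
    by (rule sum.reindex_bij_witness[of _ "\<lambda>j. L - j" "\<lambda>j. L - j"])
       (auto simp: d_def of_nat_diff sym)
  also have "(\<Sum>j\<in>{0<..<L}. d j * of_real (Z j)) = (\<Sum>a<m. d (2 * a + 1) * of_real (Z (2 * a + 1)))"
  proof -
    have "(\<Sum>j\<in>{0<..<L}. d j * of_real (Z j)) = (\<Sum>j\<in>{j\<in>{0<..<L}. odd j}. d j * of_real (Z j))"
      by (rule sum.mono_neutral_right) (auto simp: d_def even_zero)
    also have "\<dots> = (\<Sum>a<m. d (2 * a + 1) * of_real (Z (2 * a + 1)))"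
      by (rule sum.reindex_bij_witness[of _ "\<lambda>a. 2 * a + 1" "\<lambda>j. j div 2"]) (use L in \<open>auto elim!: oddE\<close>)
    finally show ?thesis .
  qed
  finally have main: "of_nat L * periodic_bernoulli f L (Suc k) =
      2 * \<kappa> * (\<Sum>a<m. d (2 * a + 1) * of_real (Z (2 * a + 1)))" by simp
  have dn: "norm (d (2 * a + 1)) = c" for a unfolding d_def by (rule const) simp
  have Z_sums: "(\<lambda>i. 1 / (real j / real L + real i) ^ Suc k) sums Z j" if "j > 0" for j
    unfolding Z_def using L0 that by (intro hurwitz_zeta_sums k0) auto
  have Z_nonneg: "Z j \<ge> 0" if "j > 0" for j
    by (rule sums_le[OF _ sums_zero Z_sums[OF that]]) auto
  have Z1: "Z 1 \<ge> real L ^ Suc k"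
  proof -
    have "(\<Sum>i<1. 1 / (real 1 / real L + real i) ^ Suc k) \<le> Z 1"
      unfolding sums_unique[OF Z_sums[of 1, simplified zero_less_one, OF TrueI]]
      by (rule sum_le_suminf[OF sums_summable[OF Z_sums]]) auto
    then show ?thesis by (simp add: power_divide)
  qed
  have Zsum: "(\<Sum>a<m. Z (2 * a + 1)) \<le> 5 / 4 * real L ^ Suc k"
    using sum_hurwitz_zeta_odd_le[OF k0 L] by (simp add: Z_def add.commute)
  have "{..<m} = insert 0 {1..<m}" using L by auto
  then have split: "(\<Sum>a<m. g a) = g 0 + (\<Sum>a\<in>{1..<m}. g a)" for g :: "nat \<Rightarrow> 'b :: comm_monoid_add"
    by simp
  have "(\<Sum>a<m. d (2 * a + 1) * of_real (Z (2 * a + 1))) \<noteq> 0"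
  proof
    assume "(\<Sum>a<m. d (2 * a + 1) * of_real (Z (2 * a + 1))) = 0"
    then have "d 1 * of_real (Z 1) = - (\<Sum>a\<in>{1..<m}. d (2 * a + 1) * of_real (Z (2 * a + 1)))"
      unfolding split by (simp add: eq_neg_iff_add_eq_0)
    then have "norm (d 1 * of_real (Z 1)) = norm (\<Sum>a\<in>{1..<m}. d (2 * a + 1) * of_real (Z (2 * a + 1)))"
      by simp
    also have "\<dots> \<le> (\<Sum>a\<in>{1..<m}. c * Z (2 * a + 1))"
      using Z_nonneg dn by (intro sum_norm_le) (auto simp: norm_mult)
    also have "\<dots> = c * (\<Sum>a\<in>{1..<m}. Z (2 * a + 1))" by (simp add: sum_distrib_left)
    finally have "c * Z 1 \<le> c * (\<Sum>a\<in>{1..<m}. Z (2 * a + 1))"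
      using dn[of 0] Z_nonneg[of 1] by (simp add: norm_mult)
    then have "Z 1 \<le> (\<Sum>a\<in>{1..<m}. Z (2 * a + 1))" using c by simp
    moreover have "Z 1 + (\<Sum>a\<in>{1..<m}. Z (2 * a + 1)) \<le> 5 / 4 * real L ^ Suc k"
      using Zsum unfolding split by simp
    ultimately have "2 * real L ^ Suc k \<le> 5 / 4 * real L ^ Suc k" using Z1 by linarith
    moreover have "real L ^ Suc k > 0" using L0 by simp
    ultimately show False by linarith
  qed
  with main \<open>\<kappa> \<noteq> 0\<close> L0 show ?thesis by auto
qed

section \<open>Orders of roots of unity and triangular numbers\<close>

lemma root_order_props:
  assumes "root_of_unity w"
  shows "root_order w > 0" "w ^ root_order w = 1"
    and "\<And>k. 0 < k \<Longrightarrow> k < root_order w \<Longrightarrow> w ^ k \<noteq> 1"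
proof -
  obtain k where k: "k > 0 \<and> w ^ k = 1" using assms by (auto simp: root_of_unity_def)
  have "root_order w > 0 \<and> w ^ root_order w = 1"
    unfolding root_order_def by (rule LeastI[of "\<lambda>k. k > 0 \<and> w ^ k = 1", OF k])
  then show "root_order w > 0" "w ^ root_order w = 1" by auto
  show "w ^ k \<noteq> 1" if "0 < k" "k < root_order w" for k
    using not_less_Least[of k "\<lambda>k. k > 0 \<and> w ^ k = 1"] that by (auto simp: root_order_def)
qed

lemma root_order_dvd_iff:
  assumes "root_of_unity w"
  shows "w ^ k = 1 \<longleftrightarrow> root_order w dvd k"
proof -
  let ?n = "root_order w"
  have "w ^ k = w ^ (?n * (k div ?n) + k mod ?n)" by simp
  also have "\<dots> = (w ^ ?n) ^ (k div ?n) * w ^ (k mod ?n)" by (simp only: power_add power_mult)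
  also have "\<dots> = w ^ (k mod ?n)" using root_order_props(2)[OF assms] by simp
  finally have "w ^ k = w ^ (k mod ?n)" .
  moreover have "w ^ (k mod ?n) = 1 \<longleftrightarrow> k mod ?n = 0"
    using root_order_props[OF assms] by (metis mod_less_divisor neq0_conv power_0)
  ultimately show ?thesis by (simp add: dvd_eq_mod_eq_0)
qed

lemma root_of_unity_minus:
  assumes "root_of_unity w" shows "root_of_unity (- w)"
proof -
  obtain k where "k > 0" "w ^ k = 1" using assms by (auto simp: root_of_unity_def)
  have "(- w) ^ (2 * k) = w ^ (2 * k)" by (simp add: power_mult)
  also have "\<dots> = (w ^ k) ^ 2" by (simp add: power_mult[symmetric] mult.commute)
  finally have "2 * k > 0" "(- w) ^ (2 * k) = 1" using \<open>k > 0\<close> \<open>w ^ k = 1\<close> by auto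
  then show ?thesis unfolding root_of_unity_def by blast
qed

text \<open>If N is the order of -w and N is odd, then w^N = -1, so the order of w divides 2 N but not N.\<close>

lemma odd_root_order_minus_iff:
  assumes "root_of_unity w"
  shows "odd (root_order (- w)) \<longleftrightarrow> root_order w mod 4 = 2"
proof
  let ?n = "root_order (- w)"
  note m = root_of_unity_minus[OF assms]
  assume odd: "odd ?n"
  then have "w ^ ?n = - 1" using root_order_props(2)[OF m] by (simp add: power_minus_odd minus_equation_iff[of _ 1])
  then have "w ^ ?n \<noteq> 1" "w ^ (2 * ?n) = 1" by (simp_all add: mult.commute[of 2] power_mult)
  then have not_dvd: "\<not> root_order w dvd ?n" and dvd: "root_order w dvd 2 * ?n"
    using root_order_dvd_iff[OF assms] by simp_all
  have "even (root_order w)"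
  proof (rule ccontr)
    assume "odd (root_order w)"
    then have "coprime (root_order w) 2" by simp
    with dvd have "root_order w dvd ?n" by (simp add: coprime_dvd_mult_right_iff)
    with not_dvd show False by contradiction
  qed
  then obtain d where d: "root_order w = 2 * d" by blast
  with dvd have "d dvd ?n" by simp
  with odd have "odd d" using dvd_trans by blast
  then show "root_order w mod 4 = 2" unfolding d by presburger
next
  note m = root_of_unity_minus[OF assms]
  assume o: "root_order w mod 4 = 2"
  define d where "d = root_order w div 2"
  have d: "root_order w = 2 * d" "odd d" using o unfolding d_def by presburger+
  have "(w ^ d) ^ 2 = 1" using root_order_props(2)[OF assms] by (simp add: d power_mult[symmetric] mult.commute)
  moreover have "w ^ d \<noteq> 1" using d odd_pos[of d] by (intro root_order_props(3)[OF assms]) auto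
  ultimately have "w ^ d = - 1" by (simp add: power2_eq_1_iff)
  then have "(- w) ^ d = 1" using d by (simp add: power_minus_odd)
  then have "root_order (- w) dvd d" using root_order_dvd_iff[OF m] by blast
  with d show "odd (root_order (- w))" using dvd_trans by blast
qed

definition triangular :: "int \<Rightarrow> int" where
  "triangular k = k * (k + 1) div 2"

lemma two_triangular: "2 * triangular k = k * (k + 1)"
  unfolding triangular_def by (simp add: dvd_mult_div_cancel)

lemma triangular_add: "triangular (k + s) = triangular k + triangular s + k * s"
proof -
  have "2 * triangular (k + s) = 2 * (triangular k + triangular s + k * s)"
    by (simp only: distrib_left two_triangular) (simp add: algebra_simps)
  then show ?thesis by simp
qed

lemma triangular_nonneg: "triangular k \<ge> 0"
proof -
  have "0 \<le> k * (k + 1)" by (cases "k \<ge> 0") (auto simp: zero_le_mult_iff)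
  then show ?thesis using two_triangular[of k] by linarith
qed

text \<open>The character chi8 is the sign (-1)^(k(k+1)/2) at 2k+1, and it merges with the power of \<zeta>.\<close>

lemma b_seq_odd:
  assumes "\<zeta> \<noteq> 0"
  shows "b_seq \<zeta> (2 * k + 1) = (- \<zeta>) powi triangular k"
proof -
  have e: "((2 * k + 1)\<^sup>2 - 1) div 8 = triangular k"
  proof -
    have "(2 * k + 1)\<^sup>2 - 1 = 8 * triangular k"
      using two_triangular[of k] by (simp add: power2_eq_square algebra_simps)
    then show ?thesis by simp
  qed
  have c: "chi8 (2 * k + 1) = (if even (triangular k) then 1 else - 1)"
  proof -
    define q r where "q = k div 4" "r = k mod 4"
    have k: "k = r + 4 * q" unfolding q_r_def by simp
    have "triangular (4 * q) = 2 * (q * (4 * q + 1))"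
      using two_triangular[of "4 * q"] by (simp add: algebra_simps)
    then have par: "even (triangular k) \<longleftrightarrow> even (triangular r)"
      unfolding k triangular_add by simp
    have mod8: "(2 * k + 1) mod 8 = (2 * r + 1) mod 8"
    proof -
      have "2 * k + 1 = 2 * r + 1 + q * 8" unfolding k by simp
      then show ?thesis by (simp only: mod_mult_self1)
    qed
    have "0 \<le> r" "r < 4" unfolding q_r_def by simp_all
    then have "r = 0 \<or> r = 1 \<or> r = 2 \<or> r = 3" by linarith
    then show ?thesis unfolding chi8_def mod8 par by (auto simp: triangular_def)
  qed
  have "of_int (chi8 (2 * k + 1)) * \<zeta> ^ nat (triangular k) = (- \<zeta>) ^ nat (triangular k)"
    unfolding c using triangular_nonneg[of k] by (auto simp: even_nat_iff power_minus_odd)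
  then show ?thesis
    unfolding b_seq_def e using triangular_nonneg[of k] by (simp add: power_int_nonneg_exp)
qed

lemma b_seq_even: "b_seq \<zeta> (2 * k) = 0"
  by (simp add: b_seq_def)

lemma b_seq_minus: "b_seq \<zeta> (- m) = b_seq \<zeta> m"
proof -
  have "(- m) mod 8 \<in> {1, 7} \<longleftrightarrow> m mod 8 \<in> {1, 7}" by simp presburger
  then have "chi8 (- m) = chi8 m" by (simp add: chi8_def)
  then show ?thesis by (simp add: b_seq_def)
qed

section \<open>Quadratic Gauss sums\<close>

text \<open>The sequence b at odd arguments 2k+1 is the chirp \<omega>^(k(k+1)/2) with \<omega> = -\<zeta>. The order N of \<omega>,
  rather than that of \<zeta>, governs its periods.\<close>

locale chirp =
  fixes \<zeta> :: complex and N :: nat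
  assumes root: "root_of_unity \<zeta>" and N_def: "N = root_order (- \<zeta>)"
begin

definition \<omega> :: complex where "\<omega> = - \<zeta>"
definition L :: nat where "L = 4 * N"

lemma root_\<omega>: "root_of_unity \<omega>" unfolding \<omega>_def by (rule root_of_unity_minus[OF root])

lemma N_pos: "N > 0" and \<omega>_N: "\<omega> ^ N = 1"
  using root_order_props[OF root_\<omega>] by (auto simp: N_def \<omega>_def)

lemma L_pos: "L > 0" using N_pos by (simp add: L_def)

lemma \<omega>_nonzero: "\<omega> \<noteq> 0"
  using \<omega>_N N_pos by (metis power_eq_0_iff zero_neq_one)

lemma norm_\<omega>: "norm \<omega> = 1"
proof (rule power_eq_imp_eq_base)
  show "norm \<omega> ^ N = 1 ^ N" using \<omega>_N by (simp flip: norm_power)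
qed (use N_pos in auto)

lemma b_odd: "b_seq \<zeta> (2 * k + 1) = \<omega> powi triangular k"
  unfolding \<omega>_def by (rule b_seq_odd) (use \<omega>_nonzero \<omega>_def in auto)

lemma \<omega>_powi_N: "\<omega> powi (int N * k) = 1"
  using \<omega>_N by (simp add: power_int_mult)

definition half_period_sign :: complex where "half_period_sign = (if even N then - 1 else 1)"

text \<open>The exponent is N (N+1) / 2. For odd N it is a multiple of N; for even N the number \<omega>^(N/2) is -1
  and N + 1 is odd.\<close>

lemma \<omega>_triangular_N: "\<omega> powi triangular (int N) = half_period_sign"
proof (cases "even N")
  case True
  then obtain m where m: "N = 2 * m" by blast
  have "(\<omega> ^ m) ^ 2 = 1" using \<omega>_N by (simp add: m power_mult[symmetric] mult.commute)
  moreover have "\<omega> ^ m \<noteq> 1"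
    unfolding root_order_dvd_iff[OF root_\<omega>] using m N_pos by (auto simp: N_def \<omega>_def dest: dvd_imp_le)
  ultimately have "\<omega> ^ m = - 1" by (simp add: power2_eq_1_iff)
  moreover have "triangular (int N) = int m * (int N + 1)"
    using two_triangular[of "int N"] m by simp
  ultimately have "\<omega> powi triangular (int N) = (- 1) powi (int N + 1)"
    by (simp add: power_int_mult)
  also have "\<dots> = - 1" using True by (simp add: power_int_add)
  finally show ?thesis using True by (simp add: half_period_sign_def)
next
  case False
  then obtain m where "int N = 2 * m + 1" by (metis even_of_nat_iff oddE)
  then have "2 * triangular (int N) = 2 * (int N * (m + 1))"
    unfolding two_triangular by (simp add: algebra_simps)
  then have "triangular (int N) = int N * (m + 1)" by simp
  then show ?thesis using False \<omega>_powi_N by (simp add: half_period_sign_def)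
qed

lemma b_shift_2N: "b_seq \<zeta> (r + 2 * int N) = half_period_sign * b_seq \<zeta> r"
proof (cases "even r")
  case True
  then obtain k where "r = 2 * k" by blast
  then show ?thesis using b_seq_even[of \<zeta> "k + int N"] b_seq_even[of \<zeta> k] by (simp add: algebra_simps)
next
  case False
  then obtain k where k: "r = 2 * k + 1" by (elim oddE)
  have "b_seq \<zeta> (r + 2 * int N) = \<omega> powi triangular (k + int N)"
    using b_odd[of "k + int N"] by (simp add: k algebra_simps)
  also have "\<dots> = \<omega> powi triangular k * half_period_sign"
    using \<omega>_nonzero \<omega>_powi_N[of k] by (simp add: triangular_add power_int_add \<omega>_triangular_N mult.commute)
  finally show ?thesis by (simp add: k b_odd)
qed

lemma b_period: "b_seq \<zeta> (r + int L) = b_seq \<zeta> r"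
proof -
  have "r + int L = r + 2 * int N + 2 * int N" by (simp add: L_def)
  then show ?thesis by (simp only: b_shift_2N) (simp add: half_period_sign_def)
qed

lemma is_period_b: "is_period (b_seq \<zeta>) L"
  using L_pos b_period by (simp add: is_period_def)

text \<open>Translation by 2N, half the period L, multiplies b by the sign and the j-th character by (-1)^j.\<close>

lemma dft_parity:
  assumes "even j \<longleftrightarrow> even N"
  shows "dft (b_seq \<zeta>) L j = 0"
proof -
  have "unity_char L (2 * int N) = - 1"
  proof -
    have "2 * pi * real_of_int (2 * int N) / real L = pi" using N_pos by (simp add: L_def)
    then show ?thesis unfolding unity_char_def by simp
  qed
  moreover have "- (j * (2 * int N)) = 2 * int N * (- j)" by simp
  ultimately have "unity_char L (- (j * (2 * int N))) = (- 1) powi (- j)"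
    by (simp only: unity_char_powi[symmetric])
  then have char: "unity_char L (- (j * (2 * int N))) = (if even j then 1 else - 1)"
    by (simp add: power_int_minus_left)
  have "dft (b_seq \<zeta>) L j = (\<Sum>r=1..L. b_seq \<zeta> (int r + 2 * int N) * unity_char L (- (j * int r))) *
      unity_char L (- (j * (2 * int N)))"
    by (rule dft_shift[OF is_period_b])
  also have "\<dots> = half_period_sign * (if even j then 1 else - 1) * dft (b_seq \<zeta>) L j"
    unfolding b_shift_2N char dft_def by (simp add: sum_distrib_left mult_ac)
  also have "half_period_sign * (if even j then 1 else - 1) = - 1" using assms by (simp add: half_period_sign_def)
  finally show ?thesis by simp
qed

text \<open>A primitive root of order N generates the group of N-th roots of unity; counting both sides avoids
  a discussion of exponents.\<close>

lemma \<omega>_generates: "\<exists>s::nat. \<omega> ^ s = unity_char L 4"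
proof -
  have "(\<lambda>s. \<omega> ^ s) ` {..<N} = {z. z ^ N = 1}"
  proof (rule card_subset_eq)
    show "finite {z::complex. z ^ N = 1}" using N_pos by (intro finite_roots_unity) auto
    show "(\<lambda>s. \<omega> ^ s) ` {..<N} \<subseteq> {z. z ^ N = 1}"
    proof (rule image_subsetI)
      fix s
      have "(\<omega> ^ s) ^ N = (\<omega> ^ N) ^ s" by (simp add: power_mult[symmetric] mult.commute)
      then show "\<omega> ^ s \<in> {z. z ^ N = 1}" by (simp add: \<omega>_N)
    qed
    have "inj_on (\<lambda>s. \<omega> ^ s) {..<N}"
    proof (rule linorder_inj_onI)
      fix a b assume ab: "a < b" "a \<in> {..<N}" "b \<in> {..<N}"
      show "\<omega> ^ a \<noteq> \<omega> ^ b"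
      proof
        assume "\<omega> ^ a = \<omega> ^ b"
        then have "\<omega> ^ (b - a) = 1" using \<omega>_nonzero ab by (simp add: power_diff)
        moreover have "0 < b - a" "b - a < root_order \<omega>" using ab by (auto simp: N_def \<omega>_def)
        ultimately show False using root_order_props(3)[OF root_\<omega>] by blast
      qed
    qed auto
    then show "card ((\<lambda>s. \<omega> ^ s) ` {..<N}) = card {z::complex. z ^ N = 1}"
      using card_complex_roots_unity[of N] N_pos by (simp add: card_image)
  qed
  moreover have "unity_char L 4 ^ N = 1"
    unfolding unity_char_power unity_char_eq_1_iff[OF L_pos] by (simp add: L_def)
  ultimately show ?thesis by (metis (mono_tags, lifting) imageE mem_Collect_eq)
qed

text \<open>Completing the square: replacing k by k + s multiplies the chirp by a constant and by \<omega>^(s k). If s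
  is chosen with \<omega>^s = exp(2 \<pi> \<i> / N), this is a character which moves the frequency by 2.\<close>

lemma norm_dft_step: "norm (dft (b_seq \<zeta>) L j) = norm (dft (b_seq \<zeta>) L (j - 2))"
proof -
  obtain s :: nat where s: "\<omega> ^ s = unity_char L 4" using \<omega>_generates by blast
  define c where "c = \<omega> powi triangular (int s) * unity_char L (- 2)"
  have shift: "b_seq \<zeta> (r + 2 * int s) = c * unity_char L (2 * r) * b_seq \<zeta> r" for r
  proof (cases "even r")
    case True
    then obtain k where "r = 2 * k" by blast
    then show ?thesis using b_seq_even[of \<zeta> "k + int s"] b_seq_even[of \<zeta> k] by (simp add: algebra_simps)
  next
    case False
    then obtain k where k: "r = 2 * k + 1" by (elim oddE)
    have "b_seq \<zeta> (r + 2 * int s) = \<omega> powi triangular (k + int s)"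
      using b_odd[of "k + int s"] by (simp add: k algebra_simps)
    also have "\<dots> = \<omega> powi triangular k * \<omega> powi triangular (int s) * (\<omega> powi int s) powi k"
      using \<omega>_nonzero by (simp add: triangular_add power_int_add power_int_mult mult.commute[of k])
    also have "(\<omega> powi int s) powi k = unity_char L (4 * k)"
      by (simp add: s unity_char_powi)
    also have "unity_char L (4 * k) = unity_char L (- 2) * unity_char L (2 * r)"
      by (simp add: unity_char_add[symmetric] k)
    also have "\<omega> powi triangular k = b_seq \<zeta> r" by (simp only: k b_odd)
    finally show ?thesis by (simp only: c_def mult_ac)
  qed
  have "dft (b_seq \<zeta>) L j = (\<Sum>r=1..L. b_seq \<zeta> (int r + 2 * int s) * unity_char L (- (j * int r))) *
      unity_char L (- (j * (2 * int s)))"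
    by (rule dft_shift[OF is_period_b])
  also have "(\<Sum>r=1..L. b_seq \<zeta> (int r + 2 * int s) * unity_char L (- (j * int r))) = c * dft (b_seq \<zeta>) L (j - 2)"
  proof -
    have "unity_char L (- ((j - 2) * int r)) = unity_char L (2 * int r) * unity_char L (- (j * int r))" for r
      by (simp add: unity_char_add[symmetric] algebra_simps)
    then show ?thesis unfolding shift dft_def sum_distrib_left by (simp add: mult_ac)
  qed
  finally have "norm (dft (b_seq \<zeta>) L j) = norm c * norm (dft (b_seq \<zeta>) L (j - 2))"
    by (simp add: norm_mult)
  moreover have "norm c = 1" using norm_\<omega> by (simp add: c_def norm_mult norm_power_int)
  ultimately show ?thesis by simp
qed

lemma norm_dft_const:
  assumes "even (j - i)"
  shows "norm (dft (b_seq \<zeta>) L j) = norm (dft (b_seq \<zeta>) L i)"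
proof -
  have "norm (dft (b_seq \<zeta>) L (i + 2 * k)) = norm (dft (b_seq \<zeta>) L i)" for k
  proof (induction k rule: int_induct[where k = 0])
    case (step1 k)
    then show ?case using norm_dft_step[of "i + 2 * (k + 1)"] by (simp add: algebra_simps)
  next
    case (step2 k)
    then show ?case using norm_dft_step[of "i + 2 * k"] by (simp add: algebra_simps)
  qed simp
  moreover obtain k where "j = i + 2 * k" using assms by (metis add.commute diff_add_cancel dvdE)
  ultimately show ?thesis by simp
qed

text \<open>If one transform in the nonzero parity class were zero, all would be, and by
  inversion b would vanish at 1.\<close>

lemma dft_nonzero:
  assumes "even i \<longleftrightarrow> odd N"
  shows "dft (b_seq \<zeta>) L i \<noteq> 0"
proof
  assume zero: "dft (b_seq \<zeta>) L i = 0"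
  have "dft (b_seq \<zeta>) L j = 0" for j
  proof (cases "even j \<longleftrightarrow> even N")
    case False
    then have "even (j - i)" using assms by auto
    then show ?thesis using norm_dft_const[of j i] zero by simp
  qed (rule dft_parity)
  then have "of_nat L * b_seq \<zeta> (int 1) = 0"
    using dft_inversion[of 1 L "b_seq \<zeta>"] L_pos by simp
  moreover have "b_seq \<zeta> (int 1) = 1" using b_odd[of 0] by (simp add: triangular_def)
  ultimately show False using L_pos by simp
qed

lemma mu_eq_dft: "mu \<zeta> = dft (b_seq \<zeta>) L 0 / of_nat L"
  unfolding mu_def mean_eq[OF is_period_b] by (simp add: dft_def)

lemma mu_nonzero: "odd N \<Longrightarrow> mu \<zeta> \<noteq> 0"
  using dft_nonzero[of 0] L_pos by (simp add: mu_eq_dft)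

lemma mu_zero: "even N \<Longrightarrow> mu \<zeta> = 0"
  using dft_parity[of 0] by (simp add: mu_eq_dft)

lemma periodic_bernoulli_b_nonzero:
  assumes "even N" "odd k"
  shows "periodic_bernoulli (b_seq \<zeta>) L (Suc k) \<noteq> 0"
proof (rule periodic_bernoulli_nonzero[where m = "2 * N" and c = "norm (dft (b_seq \<zeta>) L 1)"])
  show "dft (b_seq \<zeta>) L (int L - j) = dft (b_seq \<zeta>) L j" for j
    by (rule dft_even[OF is_period_b b_seq_minus])
  show "dft (b_seq \<zeta>) L j = 0" if "even j" for j using that assms by (intro dft_parity) simp
  show "norm (dft (b_seq \<zeta>) L j) = norm (dft (b_seq \<zeta>) L 1)" if "odd j" for j
    using that by (intro norm_dft_const) simp
  show "norm (dft (b_seq \<zeta>) L 1) > 0" using dft_nonzero[of 1] assms by simp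
qed (use assms N_pos in \<open>auto simp: L_def\<close>)

end

section \<open>Radial asymptotics\<close>

text \<open>The previous expansion with h^2 = x. The derivatives of z^(2n+1) exp(-z^2) at 0 vanish except for the
  orders 2n+1+2r, so only the terms \<beta>_(2n+2r+2) remain besides \<beta>_0, and these are L-values.\<close>

lemma gaussian_sum_expansion_L_fun:
  assumes per: "is_period f M"
  obtains C where
    "\<And>x. 0 < x \<Longrightarrow> x \<le> 1 \<Longrightarrow>
       summable (\<lambda>m. f (int (Suc m)) * (of_nat (Suc m) ^ (2*n+1) * exp (- (of_real x * of_nat (Suc m) ^ 2))))"
    "\<And>x. 0 < x \<Longrightarrow> x \<le> 1 \<Longrightarrow>
       norm ((\<Sum>m. f (int (Suc m)) * (of_nat (Suc m) ^ (2*n+1) * exp (- (of_real x * of_nat (Suc m) ^ 2))))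
         - (mean f / 2 * fact n / of_real x ^ (n + 1)
            + (\<Sum>r\<le>R. (-1) ^ r / fact r * L_fun (- of_nat (2*n + 2*r + 1)) f * of_real x ^ r)))
       \<le> C * sqrt x * x ^ R"
proof -
  note L = L_fun_neg_nat[OF per]
  \<comment> \<open>the largest K for which no term beyond r = R occurs\<close>
  define K where "K = Suc (2*n + 2*R + 2)"
  have "K > 0" by (simp add: K_def)
  then obtain C where summ: "\<And>h. 0 < h \<Longrightarrow> h \<le> 1 \<Longrightarrow>
       summable (\<lambda>m. f (int (Suc m)) * (of_nat (Suc m) ^ (2*n+1) * exp (- (of_real h * of_nat (Suc m))\<^sup>2)))"
   and bound: "\<And>h. 0 < h \<Longrightarrow> h \<le> 1 \<Longrightarrow>
       norm ((\<Sum>m. f (int (Suc m)) * (of_nat (Suc m) ^ (2*n+1) * exp (- (of_real h * of_nat (Suc m))\<^sup>2)))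
         + (\<Sum>i\<le>K. periodic_bernoulli f M i * of_real h ^ i * poly (gauss_poly n i) 0 / of_real h ^ (2*n+2)))
       \<le> C * h ^ K / h ^ (2*n+2)"
    using gaussian_sum_expansion[OF per, of K n] by blast
  have sq: "(of_real (sqrt x) * of_nat (Suc m))\<^sup>2 = (of_real x * of_nat (Suc m) ^ 2 :: complex)" if "x > 0" for x m
    using that by (simp add: power_mult_distrib flip: of_real_power)
  have main: "(\<Sum>i\<le>K. periodic_bernoulli f M i * of_real (sqrt x) ^ i * poly (gauss_poly n i) 0 / of_real (sqrt x) ^ (2*n+2))
      = - (mean f / 2 * fact n / of_real x ^ (n + 1)
            + (\<Sum>r\<le>R. (-1) ^ r / fact r * L_fun (- of_nat (2*n + 2*r + 1)) f * of_real x ^ r))"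
    if x: "x > 0" for x
  proof -
    have pw: "of_real (sqrt x) ^ (2 * j) = (of_real x ^ j :: complex)" for j
      using x by (simp add: power_mult flip: of_real_power)
    define T where "T = (\<lambda>i. periodic_bernoulli f M i * of_real (sqrt x) ^ i * poly (gauss_poly n i) 0 / of_real (sqrt x) ^ (2*n+2))"
    have "(\<Sum>i\<le>K. T i) = T 0 + (\<Sum>l\<le>2*n+2*R+2. T (Suc l))"
      unfolding K_def by (rule sum.atMost_Suc_shift)
    also have "(\<Sum>l\<le>2*n+2*R+2. T (Suc l)) = (\<Sum>l\<in>(\<lambda>r. 2*n + 2*r + 1) ` {..R}. T (Suc l))"
    proof (rule sum.mono_neutral_right)
      show "\<forall>l\<in>{..2*n+2*R+2} - (\<lambda>r. 2*n + 2*r + 1) ` {..R}. T (Suc l) = 0"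
      proof
        fix l assume l: "l \<in> {..2*n+2*R+2} - (\<lambda>r. 2*n + 2*r + 1) ` {..R}"
        have "\<not> (2*n+1 \<le> l \<and> even (l - (2*n+1)))"
        proof
          assume "2*n+1 \<le> l \<and> even (l - (2*n+1))"
          then obtain r where "2*n+1 \<le> l" "l - (2*n+1) = 2 * r" by blast
          then have "l = 2*n + 2*r + 1" by linarith
          with l show False by auto
        qed
        then have "poly (gauss_poly n (Suc l)) 0 = 0" unfolding gauss_poly_at_0 by (rule if_not_P)
        then show "T (Suc l) = 0" by (simp add: T_def)
      qed
    qed auto
    also have "\<dots> = (\<Sum>r\<le>R. T (Suc (2*n + 2*r + 1)))"
      by (subst sum.reindex) (auto simp: inj_on_def)
    also have "\<dots> = (\<Sum>r\<le>R. - ((-1) ^ r / fact r * L_fun (- of_nat (2*n + 2*r + 1)) f * of_real x ^ r))"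
    proof (intro sum.cong refl)
      fix r
      have p: "poly (gauss_poly n (Suc (2*n + 2*r + 1))) 0 = fact (2*n + 2*r + 1) * (-1) ^ r / fact r"
        unfolding gauss_poly_at_0 by simp
      have e: "Suc (2*n + 2*r + 1) = 2 * (n + 1 + r)" "2 * n + 2 = 2 * (n + 1)" by simp_all
      have "of_real (sqrt x) ^ Suc (2*n + 2*r + 1) / of_real (sqrt x) ^ (2*n+2) = (of_real x ^ r :: complex)"
        unfolding e pw using x by (simp add: power_add)
      moreover have rearrange: "b * s * p / d = b * p * (s / d)" for b s p d :: complex by simp
      have "T (Suc (2*n + 2*r + 1)) = periodic_bernoulli f M (Suc (2*n + 2*r + 1)) *
          (fact (2*n + 2*r + 1) * (-1) ^ r / fact r) *
          (of_real (sqrt x) ^ Suc (2*n + 2*r + 1) / of_real (sqrt x) ^ (2*n+2))"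
        unfolding T_def p by (rule rearrange)
      ultimately have "T (Suc (2*n + 2*r + 1)) = periodic_bernoulli f M (Suc (2*n + 2*r + 1)) *
          (fact (2*n + 2*r + 1) * (-1) ^ r / fact r) * of_real x ^ r"
        by (simp only:)
      then show "T (Suc (2*n + 2*r + 1)) = - ((-1) ^ r / fact r * L_fun (- of_nat (2*n + 2*r + 1)) f * of_real x ^ r)"
        unfolding L by (simp add: mult_ac)
    qed
    also have "T 0 = - (mean f / 2 * fact n / of_real x ^ (n + 1))"
      using pw[of "n + 1"] by (simp add: T_def periodic_bernoulli_0[OF per] gauss_antideriv_poly_at_0)
    finally show ?thesis by (simp add: T_def sum_negf)
  qed
  show ?thesis
  proof (rule that)
    fix x :: real assume x: "0 < x" "x \<le> 1"
    then have h: "0 < sqrt x" "sqrt x \<le> 1" by auto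
    show "summable (\<lambda>m. f (int (Suc m)) * (of_nat (Suc m) ^ (2*n+1) * exp (- (of_real x * of_nat (Suc m) ^ 2))))"
      using summ[OF h] unfolding sq[OF x(1)] .
    have "K = Suc (2 * (n + 1) + 2 * R)" by (simp add: K_def)
    then have error: "C * sqrt x ^ K / sqrt x ^ (2*n+2) = C * sqrt x * x ^ R"
      using x by (simp add: power_add power_mult)
    show "norm ((\<Sum>m. f (int (Suc m)) * (of_nat (Suc m) ^ (2*n+1) * exp (- (of_real x * of_nat (Suc m) ^ 2))))
         - (mean f / 2 * fact n / of_real x ^ (n + 1)
            + (\<Sum>r\<le>R. (-1) ^ r / fact r * L_fun (- of_nat (2*n + 2*r + 1)) f * of_real x ^ r)))
       \<le> C * sqrt x * x ^ R"
      using bound[OF h] unfolding main[OF x(1)] sq[OF x(1)] error by (simp only: diff_conv_add_uminus)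
  qed
qed

text \<open>Since (2k+1)^2 = 8 k(k+1)/2 + 1, the exponent t k(k+1)/2 is x (2k+1)^2 - x with x = t/8.\<close>

lemma N_series_eq_gaussian_sum:
  fixes t :: real
  assumes \<zeta>: "\<zeta> \<noteq> 0"
    and summ: "summable (\<lambda>m. b_seq \<zeta> (int (Suc m)) *
                 (of_nat (Suc m) ^ (2*n+1) * exp (- (of_real (t / 8) * of_nat (Suc m) ^ 2))))"
  shows "N_series n (\<zeta> * exp (- of_real t)) = exp (of_real (t / 8)) *
    (\<Sum>m. b_seq \<zeta> (int (Suc m)) * (of_nat (Suc m) ^ (2*n+1) * exp (- (of_real (t / 8) * of_nat (Suc m) ^ 2))))"
proof -
  define a where "a = (\<lambda>m. b_seq \<zeta> (int (Suc m)) *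
      (of_nat (Suc m) ^ (2*n+1) * exp (- (of_real (t / 8) * of_nat (Suc m) ^ 2))))"
  have odd_terms: "exp (of_real (t / 8)) * a (2 * k) =
      (-1) ^ tri k * of_nat (2 * k + 1) ^ (2 * n + 1) * (\<zeta> * exp (- of_real t)) ^ tri k" for k
  proof -
    have T: "triangular (int k) = int (tri k)"
      by (simp only: triangular_def tri_def zdiv_int of_nat_mult of_nat_add of_nat_1 of_nat_numeral)
    have b: "b_seq \<zeta> (int (Suc (2 * k))) = (- \<zeta>) ^ tri k"
      using b_seq_odd[OF \<zeta>, of "int k"] by (simp add: T add.commute)
    have "2 * int (tri k) = int k * (int k + 1)" using two_triangular[of "int k"] by (simp add: T)
    then have "int (2 * tri k) = int (k * (k + 1))"
      by (simp only: of_nat_mult of_nat_add of_nat_numeral of_nat_1)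
    then have "2 * tri k = k * (k + 1)" by (simp only: of_nat_eq_iff)
    then have "(2 * k + 1) ^ 2 = 8 * tri k + 1" by (simp add: power2_eq_square algebra_simps)
    then have "of_nat ((2 * k + 1) ^ 2) = (of_nat (8 * tri k + 1) :: complex)" by (simp only:)
    then have sq: "(of_nat (Suc (2 * k)) :: complex) ^ 2 = 8 * of_nat (tri k) + 1"
      by (simp only: of_nat_power of_nat_mult of_nat_add of_nat_numeral of_nat_1 Suc_eq_plus1)
    have "exp (of_real (t / 8)) * exp (- (of_real (t / 8) * of_nat (Suc (2 * k)) ^ 2)) =
        exp (of_nat (tri k) * (- of_real t :: complex))"
      unfolding sq by (simp add: exp_add[symmetric] algebra_simps)
    also have "\<dots> = exp (- of_real t) ^ tri k" by (rule exp_of_nat_mult)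
    finally have e: "exp (of_real (t / 8)) * exp (- (of_real (t / 8) * of_nat (Suc (2 * k)) ^ 2)) = \<dots>" .
    have "exp (of_real (t / 8)) * a (2 * k) = (- \<zeta>) ^ tri k * of_nat (Suc (2 * k)) ^ (2*n+1) *
        (exp (of_real (t / 8)) * exp (- (of_real (t / 8) * of_nat (Suc (2 * k)) ^ 2)))"
      unfolding a_def b by (simp only: mult_ac)
    also have "\<dots> = (-1) ^ tri k * of_nat (2 * k + 1) ^ (2 * n + 1) * (\<zeta> * exp (- of_real t)) ^ tri k"
      unfolding e power_minus[of \<zeta>] by (simp only: power_mult_distrib Suc_eq_plus1 mult_ac)
    finally show ?thesis .
  qed
  have even_terms: "a m = 0" if "m \<notin> range (\<lambda>k. 2 * k)" for m
  proof -
    have "odd m" using that by auto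
    then have "even (int (Suc m))" by simp
    then show ?thesis by (simp add: a_def b_seq_def)
  qed
  have "(\<Sum>k. a (2 * k)) = (\<Sum>m. a m)"
    by (rule suminf_mono_reindex) (auto simp: strict_mono_def even_terms)
  moreover have "summable (\<lambda>k. a (2 * k))"
    using summ unfolding a_def[symmetric]
    by (subst summable_mono_reindex) (auto simp: strict_mono_def even_terms)
  ultimately have "exp (of_real (t / 8)) * (\<Sum>m. a m) = (\<Sum>k. exp (of_real (t / 8)) * a (2 * k))"
    by (simp add: suminf_mult)
  also have "\<dots> = N_series n (\<zeta> * exp (- of_real t))"
    unfolding odd_terms N_series_def ..
  finally show ?thesis by (simp add: a_def)
qed

lemma N_series_expansion:
  assumes "root_of_unity \<zeta>"
  obtains C where "\<And>t::real. 0 < t \<Longrightarrow> t \<le> 8 \<Longrightarrow>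
     norm (N_series n (\<zeta> * exp (- of_real t))
           - exp (of_real (t / 8)) *
             (mu \<zeta> / 2 * fact n / of_real (t / 8) ^ (n + 1)
              + (\<Sum>r\<le>R. (-1) ^ r / fact r * L_fun (- of_nat (2 * n + 2 * r + 1)) (b_seq \<zeta>)
                         * of_real (t / 8) ^ r)))
     \<le> C * sqrt (t / 8) * norm (of_real (t / 8) ^ R :: complex)"
proof -
  obtain k where k: "k > 0" "\<zeta> ^ k = 1" using assms by (auto simp: root_of_unity_def)
  then have \<zeta>: "\<zeta> \<noteq> 0" by (metis power_eq_0_iff zero_neq_one)
  obtain C where summ:
    "\<And>x. 0 < x \<Longrightarrow> x \<le> 1 \<Longrightarrow> summable (\<lambda>m. b_seq \<zeta> (int (Suc m)) *
         (of_nat (Suc m) ^ (2*n+1) * exp (- (of_real x * of_nat (Suc m) ^ 2))))"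
   and bound: "\<And>x. 0 < x \<Longrightarrow> x \<le> 1 \<Longrightarrow>
       norm ((\<Sum>m. b_seq \<zeta> (int (Suc m)) * (of_nat (Suc m) ^ (2*n+1) * exp (- (of_real x * of_nat (Suc m) ^ 2))))
         - (mean (b_seq \<zeta>) / 2 * fact n / of_real x ^ (n + 1)
            + (\<Sum>r\<le>R. (-1) ^ r / fact r * L_fun (- of_nat (2*n + 2*r + 1)) (b_seq \<zeta>) * of_real x ^ r)))
       \<le> C * sqrt x * x ^ R"
    using gaussian_sum_expansion_L_fun[OF is_period_b_seq[OF k], of n R] by blast
  show ?thesis
  proof (rule that[of "exp 1 * C"])
    fix t :: real assume t: "0 < t" "t \<le> 8"
    then have x: "0 < t / 8" "t / 8 \<le> 1" by auto
    have "norm (exp (complex_of_real (t / 8))) \<le> exp 1" using x by simp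
    then have "norm (exp (complex_of_real (t / 8)) *
       ((\<Sum>m. b_seq \<zeta> (int (Suc m)) * (of_nat (Suc m) ^ (2*n+1) * exp (- (of_real (t / 8) * of_nat (Suc m) ^ 2))))
         - (mean (b_seq \<zeta>) / 2 * fact n / of_real (t / 8) ^ (n + 1)
            + (\<Sum>r\<le>R. (-1) ^ r / fact r * L_fun (- of_nat (2*n + 2*r + 1)) (b_seq \<zeta>) * of_real (t / 8) ^ r))))
       \<le> exp 1 * (C * sqrt (t / 8) * (t / 8) ^ R)"
      unfolding norm_mult by (intro mult_mono bound[OF x]) auto
    moreover have "norm (of_real (t / 8) ^ R :: complex) = (t / 8) ^ R"
      using x by (simp add: norm_power del: of_real_divide)
    ultimately show "norm (N_series n (\<zeta> * exp (- of_real t))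
           - exp (of_real (t / 8)) *
             (mu \<zeta> / 2 * fact n / of_real (t / 8) ^ (n + 1)
              + (\<Sum>r\<le>R. (-1) ^ r / fact r * L_fun (- of_nat (2 * n + 2 * r + 1)) (b_seq \<zeta>)
                         * of_real (t / 8) ^ r)))
     \<le> exp 1 * C * sqrt (t / 8) * norm (of_real (t / 8) ^ R :: complex)"
      unfolding N_series_eq_gaussian_sum[OF \<zeta> summ[OF x]] mu_def
      by (simp only: right_diff_distrib mult.assoc)
  qed
qed

lemma sqrt_eighth_tendsto_0: "((\<lambda>t. C * sqrt (t / 8)) \<longlongrightarrow> 0) (at_right (0::real))"
proof -
  have "((\<lambda>t. C * sqrt (t / 8)) \<longlongrightarrow> C * sqrt (0 / 8)) (at_right (0::real))"
    by (intro tendsto_intros) auto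
  then show ?thesis by simp
qed

lemma N_series_asymptotic:
  assumes "root_of_unity \<zeta>"
  shows "(\<lambda>t::real. N_series n (\<zeta> * exp (- of_real t))
           - exp (of_real (t / 8)) *
             (mu \<zeta> / 2 * fact n / of_real (t / 8) ^ (n + 1)
              + (\<Sum>r\<le>R. (-1) ^ r / fact r * L_fun (- of_nat (2 * n + 2 * r + 1)) (b_seq \<zeta>)
                         * of_real (t / 8) ^ r)))
        \<in> o[at_right 0](\<lambda>t. of_real (t / 8) ^ R)"
proof -
  obtain C where C: "\<And>t::real. 0 < t \<Longrightarrow> t \<le> 8 \<Longrightarrow>
     norm (N_series n (\<zeta> * exp (- of_real t))
           - exp (of_real (t / 8)) *
             (mu \<zeta> / 2 * fact n / of_real (t / 8) ^ (n + 1)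
              + (\<Sum>r\<le>R. (-1) ^ r / fact r * L_fun (- of_nat (2 * n + 2 * r + 1)) (b_seq \<zeta>)
                         * of_real (t / 8) ^ r)))
     \<le> C * sqrt (t / 8) * norm (of_real (t / 8) ^ R :: complex)"
    using N_series_expansion[OF assms, of n R] by blast
  show ?thesis
  proof (rule landau_o.smallI)
    fix c :: real assume "c > 0"
    then have "eventually (\<lambda>t. C * sqrt (t / 8) < c) (at_right 0)"
      by (rule order_tendstoD(2)[OF sqrt_eighth_tendsto_0])
    moreover have "eventually (\<lambda>t::real. t \<in> {0<..<8}) (at_right 0)"
      by (rule eventually_at_right_real) simp
    ultimately show "\<forall>\<^sub>F t in at_right 0. norm (N_series n (\<zeta> * exp (- of_real t))
           - exp (of_real (t / 8)) *
             (mu \<zeta> / 2 * fact n / of_real (t / 8) ^ (n + 1)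
              + (\<Sum>r\<le>R. (-1) ^ r / fact r * L_fun (- of_nat (2 * n + 2 * r + 1)) (b_seq \<zeta>)
                         * of_real (t / 8) ^ r)))
        \<le> c * norm (of_real (t / 8) ^ R :: complex)"
    proof eventually_elim
      case (elim t)
      then show ?case
        by (intro order_trans[OF C[of t]] mult_right_mono) auto
    qed
  qed
qed

lemma N_series_error_tendsto_0:
  assumes "root_of_unity \<zeta>"
  shows "((\<lambda>t::real. N_series n (\<zeta> * exp (- of_real t)) - exp (of_real (t / 8)) *
            (mu \<zeta> / 2 * fact n / of_real (t / 8) ^ (n + 1) + L_fun (- of_nat (2 * n + 1)) (b_seq \<zeta>)))
         \<longlongrightarrow> 0) (at_right 0)"
proof -
  have "(\<lambda>t::real. N_series n (\<zeta> * exp (- of_real t)) - exp (of_real (t / 8)) *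
            (mu \<zeta> / 2 * fact n / of_real (t / 8) ^ (n + 1) + L_fun (- of_nat (2 * n + 1)) (b_seq \<zeta>)))
         \<in> o[at_right 0](\<lambda>_. 1)"
    using N_series_asymptotic[OF assms, of n 0] by simp
  then show ?thesis by (simp add: smalloD_tendsto[where g = "\<lambda>_. 1", simplified])
qed

text \<open>Without the pole term, the expansion has a finite limit.\<close>

lemma N_series_tendsto_L_fun:
  assumes root: "root_of_unity \<zeta>" and mu: "mu \<zeta> = 0"
  shows "((\<lambda>t::real. N_series n (\<zeta> * exp (- of_real t))) \<longlongrightarrow> L_fun (- of_nat (2 * n + 1)) (b_seq \<zeta>)) (at_right 0)"
proof -
  let ?l = "L_fun (- of_nat (2 * n + 1)) (b_seq \<zeta>)"
  have "((\<lambda>t::real. (N_series n (\<zeta> * exp (- of_real t)) - exp (of_real (t / 8)) * ?l) + exp (of_real (t / 8)) * ?l)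
      \<longlongrightarrow> 0 + exp (of_real (0 / 8)) * ?l) (at_right 0)"
    using N_series_error_tendsto_0[OF root, of n] by (intro tendsto_intros) (simp_all add: mu)
  then show ?thesis by simp
qed

text \<open>Multiplication by x^(n+1) isolates the pole term.\<close>

lemma N_series_times_power_tendsto:
  assumes root: "root_of_unity \<zeta>"
  shows "((\<lambda>t::real. N_series n (\<zeta> * exp (- of_real t)) * of_real (t / 8) ^ (n + 1)) \<longlongrightarrow> mu \<zeta> / 2 * fact n) (at_right 0)"
proof -
  let ?l = "L_fun (- of_nat (2 * n + 1)) (b_seq \<zeta>)"
  let ?E = "\<lambda>t::real. N_series n (\<zeta> * exp (- of_real t)) - exp (of_real (t / 8)) *
            (mu \<zeta> / 2 * fact n / of_real (t / 8) ^ (n + 1) + ?l)"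
  have lim: "((\<lambda>t::real. ?E t * of_real (t / 8) ^ (n + 1) + exp (of_real (t / 8)) * (mu \<zeta> / 2 * fact n + ?l * of_real (t / 8) ^ (n + 1)))
      \<longlongrightarrow> 0 * of_real (0 / 8) ^ (n + 1) + exp (of_real (0 / 8)) * (mu \<zeta> / 2 * fact n + ?l * of_real (0 / 8) ^ (n + 1))) (at_right 0)"
    by (intro tendsto_intros N_series_error_tendsto_0[OF root]) auto
  have ev: "eventually (\<lambda>t::real. ?E t * of_real (t / 8) ^ (n + 1) +
        exp (of_real (t / 8)) * (mu \<zeta> / 2 * fact n + ?l * of_real (t / 8) ^ (n + 1)) =
      N_series n (\<zeta> * exp (- of_real t)) * of_real (t / 8) ^ (n + 1)) (at_right 0)"
  proof (rule eventually_mono[OF eventually_at_right_less])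
    fix t :: real assume "0 < t"
    then have "complex_of_real (t / 8) ^ (n + 1) \<noteq> 0" by simp
    moreover have "(a - e * (b / y + l)) * y + e * (b + l * y) = a * y" if "y \<noteq> 0" for a b e l y :: complex
      using that by (simp add: field_simps)
    ultimately show "?E t * of_real (t / 8) ^ (n + 1) +
        exp (of_real (t / 8)) * (mu \<zeta> / 2 * fact n + ?l * of_real (t / 8) ^ (n + 1)) =
      N_series n (\<zeta> * exp (- of_real t)) * of_real (t / 8) ^ (n + 1)" by blast
  qed
  have "0 * of_real (0 / 8) ^ (n + 1) + exp (of_real (0 / 8)) *
      (mu \<zeta> / 2 * fact n + ?l * of_real (0 / 8) ^ (n + 1)) = mu \<zeta> / 2 * fact n" by simp
  with Lim_transform_eventually[OF lim ev] show ?thesis by (simp only:)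
qed

theorem theorem5p2:
  fixes \<zeta> :: complex
  assumes "root_of_unity \<zeta>"
  shows
    "(\<forall>n R :: nat.
        (\<lambda>t::real. N_series n (\<zeta> * exp (- of_real t))
           - exp (of_real (t / 8)) *
             (mu \<zeta> / 2 * fact n / of_real (t / 8) ^ (n + 1)
              + (\<Sum>r\<le>R. (-1) ^ r / fact r * L_fun (- of_nat (2 * n + 2 * r + 1)) (b_seq \<zeta>)
                         * of_real (t / 8) ^ r)))
        \<in> o[at_right 0](\<lambda>t. of_real (t / 8) ^ R))
   \<and> (root_order \<zeta> mod 4 = 2 \<longrightarrow>
       (\<forall>n :: nat. (\<lambda>t::real. W_quot n (\<zeta> * exp (- of_real t)))
                  \<sim>[at_right 0] (\<lambda>t. fact n * of_real (8 / t) ^ n)))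
   \<and> (root_order \<zeta> mod 4 \<noteq> 2 \<longrightarrow>
       (\<forall>n :: nat.
          ((\<lambda>t::real. W_quot n (\<zeta> * exp (- of_real t)))
             \<longlongrightarrow> L_fun (- of_nat (2 * n + 1)) (b_seq \<zeta>) / L_fun (- 1) (b_seq \<zeta>)) (at_right 0)
        \<and> L_fun (- 1) (b_seq \<zeta>) \<noteq> 0
        \<and> L_fun (- of_nat (2 * n + 1)) (b_seq \<zeta>) / L_fun (- 1) (b_seq \<zeta>) \<noteq> 0))
   \<and> (\<exists>t0>0. \<forall>t::real. 0 < t \<and> t < t0 \<longrightarrow> D_series (\<zeta> * exp (- of_real t)) \<noteq> 0)"
proof -
  \<comment> \<open>parity of the order of -\<zeta> decides between the two regimes\<close>
  interpret chirp \<zeta> "root_order (- \<zeta>)" using assms by unfold_locales auto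
  let ?q = "\<lambda>t::real. \<zeta> * exp (- complex_of_real t)"
  let ?L = "\<lambda>n. L_fun (- of_nat (2 * n + 1)) (b_seq \<zeta>)"
  have L_nonzero: "?L n \<noteq> 0" if "root_order \<zeta> mod 4 \<noteq> 2" for n
  proof -
    have N: "even (root_order (- \<zeta>))" using that odd_root_order_minus_iff[OF assms] by blast
    note L_fun_neg_nat[OF is_period_b, of "2 * n + 1"]
    moreover have "periodic_bernoulli (b_seq \<zeta>) L (Suc (2 * n + 1)) \<noteq> 0"
      using N by (intro periodic_bernoulli_b_nonzero) auto
    ultimately show ?thesis by (metis fact_nonzero mult_eq_0_iff neg_equal_0_iff_equal)
  qed
  have lim_even: "((\<lambda>t. N_series n (?q t)) \<longlongrightarrow> ?L n) (at_right 0)" if "root_order \<zeta> mod 4 \<noteq> 2" for n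
    using that odd_root_order_minus_iff[OF assms] mu_zero
    by (intro N_series_tendsto_L_fun assms) blast
  have mu_nz: "mu \<zeta> \<noteq> 0" if "root_order \<zeta> mod 4 = 2"
    using that odd_root_order_minus_iff[OF assms] mu_nonzero by blast
  have D_nonzero: "eventually (\<lambda>t. D_series (?q t) \<noteq> 0) (at_right 0)"
  proof (cases "root_order \<zeta> mod 4 = 2")
    case True
    then have "eventually (\<lambda>t. N_series 0 (?q t) * of_real (t / 8) ^ (0 + 1) \<noteq> 0) (at_right 0)"
      using mu_nz by (intro tendsto_imp_eventually_ne[OF N_series_times_power_tendsto[OF assms]]) auto
    then show ?thesis by (rule eventually_mono) (auto simp: D_series_def)
  next
    case False
    then show ?thesis
      unfolding D_series_def by (intro tendsto_imp_eventually_ne[OF lim_even] L_nonzero)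
  qed
  have "(\<lambda>t. W_quot n (?q t)) \<sim>[at_right 0] (\<lambda>t. fact n * of_real (8 / t) ^ n)"
    if "root_order \<zeta> mod 4 = 2" for n
  proof (rule asymp_equivI')
    have "((\<lambda>t. (N_series n (?q t) * of_real (t / 8) ^ (n + 1)) / (N_series 0 (?q t) * of_real (t / 8) ^ (0 + 1)) / fact n)
        \<longlongrightarrow> (mu \<zeta> / 2 * fact n) / (mu \<zeta> / 2 * fact 0) / fact n) (at_right 0)"
      using mu_nz[OF that]
      by (intro tendsto_divide tendsto_const N_series_times_power_tendsto[OF assms]) auto
    also have "(mu \<zeta> / 2 * fact n) / (mu \<zeta> / 2 * fact 0) / fact n = 1"
      using mu_nz[OF that] by simp
    finally have lim: "((\<lambda>t. (N_series n (?q t) * of_real (t / 8) ^ (n + 1)) / (N_series 0 (?q t) * of_real (t / 8) ^ (0 + 1)) / fact n)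
        \<longlongrightarrow> 1) (at_right 0)" .
    show "((\<lambda>t. W_quot n (?q t) / (fact n * of_real (8 / t) ^ n)) \<longlongrightarrow> 1) (at_right 0)"
    proof (rule Lim_transform_eventually[OF lim], rule eventually_mono[OF eventually_at_right_less])
      fix t :: real assume t: "0 < t"
      have e: "complex_of_real (8 / t) ^ n = 1 / of_real (t / 8) ^ n"
        by (simp add: power_divide)
      have "complex_of_real (t / 8) \<noteq> 0" using t by simp
      then have "(a * y ^ (n + 1)) / (b * y ^ (0 + 1)) / c = a / b / (c * (1 / y ^ n))"
        if "y = complex_of_real (t / 8)" for a b c y :: complex
        using that by (cases "b = 0"; cases "c = 0") (auto simp: field_simps)
      then show "(N_series n (?q t) * of_real (t / 8) ^ (n + 1)) / (N_series 0 (?q t) * of_real (t / 8) ^ (0 + 1)) / fact n =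
          W_quot n (?q t) / (fact n * of_real (8 / t) ^ n)"
        unfolding W_quot_def D_series_def e by blast
    qed
  qed
  moreover have "((\<lambda>t. W_quot n (?q t)) \<longlongrightarrow> ?L n / L_fun (- 1) (b_seq \<zeta>)) (at_right 0)
        \<and> L_fun (- 1) (b_seq \<zeta>) \<noteq> 0 \<and> ?L n / L_fun (- 1) (b_seq \<zeta>) \<noteq> 0"
    if ne: "root_order \<zeta> mod 4 \<noteq> 2" for n
  proof -
    have "?L 0 = L_fun (- 1) (b_seq \<zeta>)" by simp
    then show ?thesis
      using tendsto_divide[OF lim_even[OF ne, of n] lim_even[OF ne, of 0] L_nonzero[OF ne, of 0]]
        L_nonzero[OF ne, of 0] L_nonzero[OF ne, of n]
      by (simp add: W_quot_def D_series_def)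
  qed
  moreover have "\<exists>t0>0. \<forall>t::real. 0 < t \<and> t < t0 \<longrightarrow> D_series (?q t) \<noteq> 0"
    using D_nonzero unfolding eventually_at_right_field by blast
  ultimately show ?thesis using N_series_asymptotic[OF assms] by blast
qed

end
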